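(* Let $F$ be a CA on $S^{\mathbb{Z}^d}$ with neighbourhood $\mathcal{N}$, local rule $f$, and spreading symbol $\alpha\in S$. Let $0<\varepsilon\le 1$, let $q$ be a probability distribution on $S$ with $q(\alpha)>0$, and let $\theta(a,b)=(1-\varepsilon)\delta_a(b)+\varepsilon q(b)$ (an $\alpha$-positive memoryless noise). Then the PCA with neighbourhood $\mathcal{N}$ and local rule $\varphi(a_1,\dots,a_m)(b)=\theta\big(f(a_1,\dots,a_m),b\big)$ is uniformly ergodic. Furthermore, its unique invariant measure is spatially mixing and admits a perfect sampling algorithm.
   Context: Let $S$ be a finite set, $d\ge 1$, and $\mathcal{X}=S^{\mathbb{Z}^d}$ with the product topology. For finite $K\subseteq\mathbb{Z}^d$ and $y_K\in S^K$, the cylinder $[y_K]$ is $\{x\in\mathcal{X}: x_k=y_k\ \forall k\in K\}$. For $k\in\mathbb{Z}^d$ the shift is $(\sigma^k x)_i=x_{k+i}$. $\delta_a$ is the unit mass at $a$. A cellular automaton (CA) with neighbourhood $\mathcal{N}=\{n_1,\dots,n_m\}\subseteq\mathbb{Z}^d$ and local rule $f:S^m\to S$ is the map $(Fx)_k=f(x_{k+n_1},\dots,x_{k+n_m})$. A symbol $\alpha\in S$ is spreading under $F$ if $|\mathcal{N}|\ge2$ and $(Fx)_k=\alpha$ whenever $x_{k+n}=\alpha$ for some $n\in\mathcal{N}$. A probabilistic cellular automaton (PCA) with neighbourhood $\mathcal{N}$ and local rule $\varphi:S^m\times S\to[0,1]$ (a stochastic matrix) is the Markov kernel $\Phi$ on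 $\mathcal{X}$ with $\Phi(x,[y_K])=\prod_{k\in K}\varphi(x_{k+n_1},\dots,x_{k+n_m})(y_k)$ for every cylinder $[y_K]$. A Borel probability measure $\pi$ on $\mathcal{X}$ is invariant if $\pi\Phi=\pi$. $\Phi$ is uniformly ergodic if it has a unique invariant measure $\pi$ and $\Phi^t(x,[u])\to\pi([u])$ as $t\to\infty$, uniformly in $x\in\mathcal{X}$, for each cylinder $[u]$. $\pi$ is spatially mixing if $\lim_{k\to\infty}\pi([u]\cap\sigma^{-k}[v])=\pi([u])\pi([v])$ for all cylinders $[u],[v]$. A perfect sampling algorithm for a probability measure $\mu$ on $\mathcal{X}$ is an algorithm that, given a finite set $A\subseteq\mathbb{Z}^d$ and using an unbounded source of independent uniform samples from $[0,1]$ (and with access to a symbolic presentation of the real transition probabilities of the PCA), outputs a random pattern $W_A\in S^A$ with $\mathbb{P}(W_A=w)=\mu([w])$ for all $w\in S^A$. *)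

theory Defs
  imports "HOL-Probability.Probability"
begin

section \<open>Configurations\<close>

text \<open>
  The lattice is \<^typ>\<open>int ^ 'd\<close> with \<open>'d\<close> a finite index type, and the finite alphabet is a finite
  type \<open>'s\<close>. The Borel sigma-algebra of the product topology on the configuration space is the product
  sigma-algebra below (see \<open>sets_configs_eq_borel\<close>).
\<close>

type_synonym ('d, 's) config = "int ^ 'd \<Rightarrow> 's"

definition configs :: "('d::finite, 's::finite) config measure" where
  "configs = Pi\<^sub>M UNIV (\<lambda>_. count_space UNIV)"

text \<open>A pattern on \<open>K\<close> is given by any function that extends it; values outside \<open>K\<close> are irrelevant.\<close>

definition cyl :: "(int ^ 'd) set \<Rightarrow> (int ^ 'd \<Rightarrow> 's) \<Rightarrow> ('d, 's) config set" where
  "cyl K y = {x. \<forall>k\<in>K. x k = y k}"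

definition shift :: "int ^ 'd \<Rightarrow> ('d, 's) config \<Rightarrow> ('d, 's) config" where
  "shift k x = (\<lambda>i. x (k + i))"


section \<open>Cellular automata and probabilistic cellular automata\<close>

text \<open>
  A neighbourhood with \<open>m\<close> elements is an injective function \<open>nb\<close> from a finite index type \<open>'m\<close>, and
  \<open>'m \<Rightarrow> 's\<close> is the set of \<open>m\<close>-tuples of symbols.
\<close>

definition ca :: "('m \<Rightarrow> int ^ 'd) \<Rightarrow> (('m \<Rightarrow> 's) \<Rightarrow> 's) \<Rightarrow> ('d, 's) config \<Rightarrow> ('d, 's) config" where
  "ca nb f x = (\<lambda>k. f (\<lambda>i. x (k + nb i)))"

definition spreading :: "('m::finite \<Rightarrow> int ^ 'd) \<Rightarrow> (('m \<Rightarrow> 's) \<Rightarrow> 's) \<Rightarrow> 's \<Rightarrow> bool" where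
  "spreading nb f \<alpha> \<longleftrightarrow>
     card (range nb) \<ge> 2 \<and>
     (\<forall>x k. (\<exists>n\<in>range nb. x (k + n) = \<alpha>) \<longrightarrow> ca nb f x k = \<alpha>)"

definition stochastic :: "(('m \<Rightarrow> 's::finite) \<Rightarrow> 's \<Rightarrow> real) \<Rightarrow> bool" where
  "stochastic \<phi> \<longleftrightarrow> (\<forall>a. (\<forall>b. 0 \<le> \<phi> a b) \<and> (\<Sum>b\<in>UNIV. \<phi> a b) = 1)"

text \<open>
  All cells are updated independently; for a stochastic local rule this is the Markov kernel determined
  by the usual formula for the probabilities of cylinders, see \<open>measure_pca_cyl\<close> and
  \<open>measurable_pca\<close>.
\<close>

definition pca :: "('m \<Rightarrow> int ^ 'd) \<Rightarrow> (('m \<Rightarrow> 's) \<Rightarrow> 's \<Rightarrow> real) \<Rightarrow>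
    ('d::finite, 's::finite) config \<Rightarrow> ('d, 's) config measure" where
  "pca nb \<phi> x =
     Pi\<^sub>M UNIV (\<lambda>k. point_measure UNIV (\<lambda>b. ennreal (\<phi> (\<lambda>i. x (k + nb i)) b)))"

definition memoryless_noise :: "real \<Rightarrow> 's pmf \<Rightarrow> 's \<Rightarrow> 's \<Rightarrow> real" where
  "memoryless_noise \<epsilon> q a b = (1 - \<epsilon>) * indicator {a} b + \<epsilon> * pmf q b"

definition noisy_rule :: "real \<Rightarrow> 's pmf \<Rightarrow> (('m \<Rightarrow> 's) \<Rightarrow> 's) \<Rightarrow> ('m \<Rightarrow> 's) \<Rightarrow> 's \<Rightarrow> real" where
  "noisy_rule \<epsilon> q f a b = memoryless_noise \<epsilon> q (f a) b"


section \<open>Ergodicity and mixing\<close>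

definition invariant_measure ::
    "(('d::finite, 's::finite) config \<Rightarrow> ('d, 's) config measure) \<Rightarrow> ('d, 's) config measure \<Rightarrow> bool" where
  "invariant_measure \<Phi> \<pi> \<longleftrightarrow> \<pi> \<in> space (prob_algebra configs) \<and> \<pi> \<bind> \<Phi> = \<pi>"

primrec kernel_pow ::
    "(('d::finite, 's::finite) config \<Rightarrow> ('d, 's) config measure) \<Rightarrow> nat \<Rightarrow>
     ('d, 's) config \<Rightarrow> ('d, 's) config measure" where
  "kernel_pow \<Phi> 0 x = return configs x"
| "kernel_pow \<Phi> (Suc t) x = kernel_pow \<Phi> t x \<bind> \<Phi>"

definition uniformly_ergodic ::
    "(('d::finite, 's::finite) config \<Rightarrow> ('d, 's) config measure) \<Rightarrow> bool" where
  "uniformly_ergodic \<Phi> \<longleftrightarrow>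
     (\<exists>\<pi>. invariant_measure \<Phi> \<pi> \<and>
          (\<forall>\<pi>'. invariant_measure \<Phi> \<pi>' \<longrightarrow> \<pi>' = \<pi>) \<and>
          (\<forall>K u. finite K \<longrightarrow>
             uniform_limit UNIV (\<lambda>t x. measure (kernel_pow \<Phi> t x) (cyl K u))
               (\<lambda>x. measure \<pi> (cyl K u)) sequentially))"

text \<open>On the lattice, \<open>k \<rightarrow> \<infinity>\<close> means that \<open>k\<close> leaves every finite set.\<close>

definition spatially_mixing :: "('d::finite, 's::finite) config measure \<Rightarrow> bool" where
  "spatially_mixing \<pi> \<longleftrightarrow>
     (\<forall>K u L v. finite K \<longrightarrow> finite L \<longrightarrow>
        ((\<lambda>k. measure \<pi> (cyl K u \<inter> shift k -` cyl L v)) \<longlongrightarrow>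
           measure \<pi> (cyl K u) * measure \<pi> (cyl L v)) cofinite)"


section \<open>Perfect sampling algorithms\<close>

text \<open>
  Algorithms are recursive programs in the style of McCarthy. They operate on symbols, exact real
  numbers (only through field operations and comparisons) and nested lists of these. The only
  constants are integers, symbols, the empty list and, as the symbolic presentation of the PCA, the
  transition probabilities \<open>TransProb a b\<close>, which denotes \<open>\<phi> a b\<close>. Randomness comes from an infinite
  sequence \<open>U\<close> of independent uniform samples; \<open>Uniform e\<close> reads the sample whose number is the value
  of \<open>e\<close>, and reading the same number again yields the same sample.

  A program is a finite list of function bodies, which may call each other by position. \<open>Var i\<close> is the
  \<open>i\<close>th argument of the current function. A computation that diverges or gets stuck has no value.
\<close>

datatype 's val = VNum real | VSym 's | VNil | VCons "'s val" "'s val"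

datatype arith_op = Plus | Minus | Times | Divide

datatype ('m, 's) expr =
    Var nat
  | IntConst int
  | SymConst 's
  | TransProb "'m \<Rightarrow> 's" 's
  | Uniform "('m, 's) expr"
  | Arith arith_op "('m, 's) expr" "('m, 's) expr"
  | Nil
  | Cons "('m, 's) expr" "('m, 's) expr"
  | Head "('m, 's) expr"
  | Tail "('m, 's) expr"
  | IfEq "('m, 's) expr" "('m, 's) expr" "('m, 's) expr" "('m, 's) expr"
  | IfLess "('m, 's) expr" "('m, 's) expr" "('m, 's) expr" "('m, 's) expr"
  | Call nat "('m, 's) expr list"

hide_const (open) Nil Cons

type_synonym ('m, 's) program = "('m, 's) expr list"

fun arith :: "arith_op \<Rightarrow> real \<Rightarrow> real \<Rightarrow> real" where
  "arith Plus r s = r + s"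
| "arith Minus r s = r - s"
| "arith Times r s = r * s"
| "arith Divide r s = r / s"

inductive eval ::
    "('m, 's) program \<Rightarrow> (('m \<Rightarrow> 's) \<Rightarrow> 's \<Rightarrow> real) \<Rightarrow> (nat \<Rightarrow> real) \<Rightarrow>
     's val list \<Rightarrow> ('m, 's) expr \<Rightarrow> 's val \<Rightarrow> bool"
  and eval_list ::
    "('m, 's) program \<Rightarrow> (('m \<Rightarrow> 's) \<Rightarrow> 's \<Rightarrow> real) \<Rightarrow> (nat \<Rightarrow> real) \<Rightarrow>
     's val list \<Rightarrow> ('m, 's) expr list \<Rightarrow> 's val list \<Rightarrow> bool"
  for P \<phi> U where
  Var: "i < length env \<Longrightarrow> eval P \<phi> U env (Var i) (env ! i)"
| IntConst: "eval P \<phi> U env (IntConst z) (VNum (of_int z))"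
| SymConst: "eval P \<phi> U env (SymConst b) (VSym b)"
| TransProb: "eval P \<phi> U env (TransProb a b) (VNum (\<phi> a b))"
| Uniform: "eval P \<phi> U env e (VNum (of_nat n)) \<Longrightarrow> eval P \<phi> U env (Uniform e) (VNum (U n))"
| Arith: "eval P \<phi> U env e1 (VNum r) \<Longrightarrow> eval P \<phi> U env e2 (VNum s) \<Longrightarrow>
    eval P \<phi> U env (Arith opr e1 e2) (VNum (arith opr r s))"
| Nil: "eval P \<phi> U env expr.Nil VNil"
| Cons: "eval P \<phi> U env e1 v \<Longrightarrow> eval P \<phi> U env e2 w \<Longrightarrow>
    eval P \<phi> U env (expr.Cons e1 e2) (VCons v w)"
| Head: "eval P \<phi> U env e (VCons v w) \<Longrightarrow> eval P \<phi> U env (Head e) v"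
| Tail: "eval P \<phi> U env e (VCons v w) \<Longrightarrow> eval P \<phi> U env (Tail e) w"
| IfEq: "eval P \<phi> U env e1 v \<Longrightarrow> eval P \<phi> U env e2 w \<Longrightarrow>
    eval P \<phi> U env (if v = w then e3 else e4) z \<Longrightarrow> eval P \<phi> U env (IfEq e1 e2 e3 e4) z"
| IfLess: "eval P \<phi> U env e1 (VNum r) \<Longrightarrow> eval P \<phi> U env e2 (VNum s) \<Longrightarrow>
    eval P \<phi> U env (if r < s then e3 else e4) z \<Longrightarrow> eval P \<phi> U env (IfLess e1 e2 e3 e4) z"
| Call: "g < length P \<Longrightarrow> eval_list P \<phi> U env es vs \<Longrightarrow> eval P \<phi> U vs (P ! g) z \<Longrightarrow>
    eval P \<phi> U env (Call g es) z"
| List_Nil: "eval_list P \<phi> U env [] []"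
| List_Cons: "eval P \<phi> U env e v \<Longrightarrow> eval_list P \<phi> U env es vs \<Longrightarrow>
    eval_list P \<phi> U env (e # es) (v # vs)"

text \<open>
  The input is the list of the elements of \<open>A\<close>, each given as the list of its \<open>d\<close> integer coordinates in
  a fixed order; the output is the list of the symbols of the sampled pattern in the same order.
\<close>

definition val_of_list :: "'s val list \<Rightarrow> 's val" where
  "val_of_list vs = foldr VCons vs VNil"

definition encode_site :: "int ^ 'd::finite \<Rightarrow> 's val" where
  "encode_site k =
     val_of_list (map (\<lambda>j. VNum (of_int (k $ from_nat_into UNIV j))) [0..<CARD('d)])"

definition outputs ::
    "('m, 's) program \<Rightarrow> (('m \<Rightarrow> 's) \<Rightarrow> 's \<Rightarrow> real) \<Rightarrow> (nat \<Rightarrow> real) \<Rightarrow>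
     (int ^ 'd::finite) list \<Rightarrow> (int ^ 'd \<Rightarrow> 's) \<Rightarrow> bool" where
  "outputs P \<phi> U ks w \<longleftrightarrow>
     eval P \<phi> U [val_of_list (map encode_site ks)] (Call 0 [Var 0])
       (val_of_list (map (\<lambda>k. VSym (w k)) ks))"

definition uniform_source :: "(nat \<Rightarrow> real) measure" where
  "uniform_source = Pi\<^sub>M UNIV (\<lambda>_. uniform_measure lborel {0..1})"

text \<open>
  The program is fixed and receives \<open>A = set ks\<close> as input. Almost sure termination need not be required
  separately: evaluation is deterministic (\<open>eval_deterministic\<close>), and the probabilities of the finitely
  many possible outputs add up to one.
\<close>

definition perfect_sampler ::
    "('m, 's) program \<Rightarrow> (('m \<Rightarrow> 's) \<Rightarrow> 's \<Rightarrow> real) \<Rightarrow> ('d::finite, 's) config measure \<Rightarrow> bool" where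
  "perfect_sampler P \<phi> \<mu> \<longleftrightarrow>
     (\<forall>ks w. distinct ks \<longrightarrow>
        {U \<in> space uniform_source. outputs P \<phi> U ks w} \<in> sets uniform_source \<and>
        measure uniform_source {U \<in> space uniform_source. outputs P \<phi> U ks w} =
          measure \<mu> (cyl (set ks) w))"

definition admits_perfect_sampling ::
    "(('m \<Rightarrow> 's) \<Rightarrow> 's \<Rightarrow> real) \<Rightarrow> ('d::finite, 's) config measure \<Rightarrow> bool" where
  "admits_perfect_sampling \<phi> \<mu> \<longleftrightarrow> (\<exists>P. perfect_sampler P \<phi> \<mu>)"


section \<open>Consistency of the definitions\<close>

lemma sets_configs_eq_borel:
  "sets (configs :: ('d::finite, 's::{finite, discrete_topology, second_countable_topology}) config measure)
     = sets borel"
proof -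
  have "sets (borel :: 's measure) = UNIV"
    by (intro set_eqI iffI UNIV_I borel_open Topological_Spaces.open_discrete)
  then have "sets (Pi\<^sub>M UNIV (\<lambda>_::int ^ 'd. count_space (UNIV :: 's set)))
      = sets (Pi\<^sub>M UNIV (\<lambda>_::int ^ 'd. borel :: 's measure))"
    by (intro sets_PiM_cong) auto
  then show ?thesis
    by (simp add: configs_def sets_PiM_equal_borel)
qed

lemma stochastic_noisy_rule:
  fixes q :: "'s::finite pmf"
  assumes "0 \<le> \<epsilon>" "\<epsilon> \<le> 1"
  shows "stochastic (noisy_rule \<epsilon> q f)"
proof -
  have q: "(\<Sum>b\<in>UNIV. pmf q b) = 1"
    by (rule sum_pmf_eq_1) auto
  have "(\<Sum>b\<in>UNIV. indicator {a} b :: real) = 1" for a :: 's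
    by (simp add: indicator_def)
  with q show ?thesis
    using assms
    by (auto simp: stochastic_def noisy_rule_def memoryless_noise_def sum.distrib
        simp flip: sum_distrib_left)
qed

lemma sets_pca: "sets (pca nb \<phi> x) = sets configs"
  unfolding pca_def configs_def by (rule sets_PiM_cong) (auto simp: sets_point_measure)

lemma prob_space_local:
  fixes \<phi> :: "('m \<Rightarrow> 's::finite) \<Rightarrow> 's \<Rightarrow> real"
  assumes "stochastic \<phi>"
  shows "prob_space (point_measure UNIV (\<lambda>b. ennreal (\<phi> a b)))"
  using assms
  by (intro prob_spaceI)
    (auto simp: emeasure_point_measure_finite space_point_measure stochastic_def sum_ennreal)

lemma prob_space_pca: "stochastic \<phi> \<Longrightarrow> prob_space (pca nb \<phi> x)"
  unfolding pca_def by (intro prob_space_PiM prob_space_local)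

lemma emeasure_pca_box:
  assumes "stochastic \<phi>" "finite K"
  shows "emeasure (pca nb \<phi> x) {z. \<forall>k\<in>K. z k \<in> X k} =
    (\<Prod>k\<in>K. \<Sum>b\<in>X k. ennreal (\<phi> (\<lambda>i. x (k + nb i)) b))"
proof -
  let ?M = "\<lambda>k. point_measure UNIV (\<lambda>b. ennreal (\<phi> (\<lambda>i. x (k + nb i)) b))"
  interpret product_prob_space ?M UNIV
    using assms by (intro product_prob_spaceI prob_space_local)
  have "space (Pi\<^sub>M UNIV ?M) = UNIV"
    by (auto simp: space_PiM space_point_measure)
  then show ?thesis
    using emeasure_PiM_Collect[of K X] assms
    by (simp add: pca_def sets_point_measure emeasure_point_measure_finite)
qed

lemma measure_pca_cyl:
  assumes "stochastic \<phi>" "finite K"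
  shows "measure (pca nb \<phi> x) (cyl K y) = (\<Prod>k\<in>K. \<phi> (\<lambda>i. x (k + nb i)) (y k))"
proof -
  have "emeasure (pca nb \<phi> x) (cyl K y) = ennreal (\<Prod>k\<in>K. \<phi> (\<lambda>i. x (k + nb i)) (y k))"
    using emeasure_pca_box[OF assms, of nb x "\<lambda>k. {y k}"] assms(1)
    by (simp add: cyl_def stochastic_def prod_ennreal)
  then show ?thesis
    using assms(1) by (simp add: measure_def stochastic_def prod_nonneg)
qed

lemma measurable_pca:
  fixes nb :: "'m::finite \<Rightarrow> int ^ 'd::finite" and \<phi> :: "('m \<Rightarrow> 's::finite) \<Rightarrow> 's \<Rightarrow> real"
  assumes "stochastic \<phi>"
  shows "pca nb \<phi> \<in> configs \<rightarrow>\<^sub>M prob_algebra configs"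
proof -
  have meas: "(\<lambda>x. g (\<lambda>i. x (k + nb i))) \<in> borel_measurable configs"
    for g :: "('m \<Rightarrow> 's) \<Rightarrow> ennreal" and k
  proof -
    have "(\<lambda>x. (\<lambda>i. x (k + nb i))) \<in> configs \<rightarrow>\<^sub>M Pi\<^sub>M UNIV (\<lambda>_::'m. count_space (UNIV :: 's set))"
      unfolding configs_def by (intro measurable_PiM_single') (auto intro!: measurable_component_singleton)
    moreover have "Pi\<^sub>M UNIV (\<lambda>_::'m. count_space (UNIV :: 's set)) = count_space UNIV"
      by (subst count_space_PiM_finite) (auto simp: PiE_UNIV_domain)
    ultimately show ?thesis
      by (auto intro: measurable_compose)
  qed
  show ?thesis
  proof (rule measurable_prob_algebra_generated)
    show "sets configs = sigma_sets (\<Pi>\<^sub>E i\<in>UNIV. space (count_space (UNIV :: 's set)))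
        (prod_algebra UNIV (\<lambda>_::int ^ 'd. count_space (UNIV :: 's set)))"
      unfolding configs_def by (rule sets_PiM)
    fix A assume "A \<in> prod_algebra UNIV (\<lambda>_::int ^ 'd. count_space (UNIV :: 's set))"
    then obtain J E where JE: "A = prod_emb UNIV (\<lambda>_. count_space UNIV) J (Pi\<^sub>E J E)" "finite J"
      by (rule prod_algebraE)
    then have "A = {z. \<forall>k\<in>J. z k \<in> E k}"
      by (auto simp: prod_emb_def PiE_iff)
    then have "emeasure (pca nb \<phi> x) A = (\<Prod>k\<in>J. \<Sum>b\<in>E k. ennreal (\<phi> (\<lambda>i. x (k + nb i)) b))" for x
      using emeasure_pca_box[OF assms \<open>finite J\<close>] by simp
    then show "(\<lambda>x. emeasure (pca nb \<phi> x) A) \<in> borel_measurable configs"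
      using meas by simp
  qed (use assms in \<open>auto simp: prob_space_pca sets_pca Int_stable_prod_algebra
      dest: subsetD[OF prod_algebra_sets_into_space]\<close>)
qed

inductive_cases eval_cases:
  "eval P \<phi> U env (Var i) v" "eval P \<phi> U env (IntConst z) v" "eval P \<phi> U env (SymConst b) v"
  "eval P \<phi> U env (TransProb a b) v" "eval P \<phi> U env (Uniform e) v"
  "eval P \<phi> U env (Arith opr e1 e2) v" "eval P \<phi> U env expr.Nil v"
  "eval P \<phi> U env (expr.Cons e1 e2) v" "eval P \<phi> U env (Head e) v" "eval P \<phi> U env (Tail e) v"
  "eval P \<phi> U env (IfEq e1 e2 e3 e4) v" "eval P \<phi> U env (IfLess e1 e2 e3 e4) v"
  "eval P \<phi> U env (Call g es) v" "eval_list P \<phi> U env [] vs" "eval_list P \<phi> U env (e # es) vs"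

lemma
  shows eval_deterministic: "eval P \<phi> U env e v \<Longrightarrow> eval P \<phi> U env e v' \<Longrightarrow> v' = v"
    and eval_list_deterministic:
      "eval_list P \<phi> U env es vs \<Longrightarrow> eval_list P \<phi> U env es vs' \<Longrightarrow> vs' = vs"
proof (induction arbitrary: v' and vs' rule: eval_eval_list.inducts)
  case (Var i env)
  from Var.prems show ?case by (rule eval_cases) (simp)
next
  case (IntConst env z)
  from IntConst.prems show ?case by (rule eval_cases) (simp)
next
  case (SymConst env b)
  from SymConst.prems show ?case by (rule eval_cases) (simp)
next
  case (TransProb env a b)
  from TransProb.prems show ?case by (rule eval_cases) (simp)
next
  case (Uniform env e n)
  from Uniform.prems show ?case by (rule eval_cases) (use Uniform.IH in fastforce)
next
  case (Arith env e1 r e2 s opr)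
  from Arith.prems show ?case by (rule eval_cases) (use Arith.IH in fastforce)
next
  case (Nil env)
  from Nil.prems show ?case by (rule eval_cases) (simp)
next
  case (Cons env e1 v e2 w)
  from Cons.prems show ?case by (rule eval_cases) (use Cons.IH in blast)
next
  case (Head env e v w)
  from Head.prems show ?case by (rule eval_cases) (use Head.IH in blast)
next
  case (Tail env e v w)
  from Tail.prems show ?case by (rule eval_cases) (use Tail.IH in blast)
next
  case (IfEq env e1 v e2 w e3 e4 z)
  from IfEq.prems show ?case by (rule eval_cases) (use IfEq.IH in blast)
next
  case (IfLess env e1 r e2 s e3 e4 z)
  from IfLess.prems show ?case by (rule eval_cases) (use IfLess.IH in blast)
next
  case (Call g env es vs z)
  from Call.prems show ?case by (rule eval_cases) (use Call.IH in blast)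
next
  case (List_Nil env)
  from List_Nil.prems show ?case by (rule eval_cases) (simp)
next
  case (List_Cons env e v es vs)
  from List_Cons.prems show ?case by (rule eval_cases) (use List_Cons.IH in blast)
qed

end

(* Split every update into noise, which picks a symbol b with weight c b, and an application of f.
   The symbol of a cell is explored backwards in time through its noiseless ancestors. As alpha
   spreads, the symbol is determined as soon as the exploration meets alpha-noise, and also if it
   dies out. A living exploration has a cell in every layer, and each such cell carries alpha-noise with
   probability c alpha, independently of the later layers; hence a symbol is still undetermined at
   depth r with probability at most (1 - c alpha)^r. Coupling from the past then yields the invariant
   measure as the law of the determined symbols, uniform exponential convergence, mixing (symbols
   determined at bounded depth depend on bounded sets of samples), and a program that deepens the
   exploration until all requested symbols are determined. *)

theory Submission
  imports Defs
begin

text \<open>The weights \<open>c\<close> stay abstract because the program sees entries of \<phi>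
  only, not \<epsilon> or \<open>q\<close>. The natural weight \<epsilon> q(b) is such an entry as
  soon as some tuple is not mapped to b by f; if f is constant, no tuple avoids \<alpha>, and a
  whole row of \<phi> is taken as noise. Layers are counted into the past and every space-time cell
  owns one fixed sample, so the state of layer t is a function of the layers from t on. Invariance
  arises as a relation between neighbouring layers, whose laws are identified through convergence
  rather than by relabelling samples. The decay is proved for finite sets of cells, not for single
  cells: a union bound over neighbours would cost a factor per layer and demand strong noise. When
  no cell of the set may be known to carry \<alpha>, one \<alpha>-noise settles the whole set, and
  every \<epsilon> > 0 suffices.\<close>

section \<open>Independent uniform samples\<close>

text \<open>A box over \<open>J\<close> pulls back to a box over \<open>J \<inter> A\<close> in the
  first copy times a box over \<open>J - A\<close> in the second, and the product formula multiplies
  the two.\<close>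

lemma distr_merge_PiM:
  fixes N :: "'i \<Rightarrow> 'a measure"
  assumes "\<And>i. prob_space (N i)"
  shows "distr (PiM UNIV N \<Otimes>\<^sub>M PiM UNIV N) (PiM UNIV N) (\<lambda>(U, V) i. if i \<in> A then U i else V i)
    = PiM UNIV N"
proof -
  interpret product_prob_space N UNIV
    using assms by (intro product_prob_spaceI)
  let ?M = "PiM UNIV N"
  let ?m = "\<lambda>(U, V) i. if i \<in> A then U i else V i"
  interpret P2: pair_prob_space ?M ?M ..
  have [measurable]: "?m \<in> ?M \<Otimes>\<^sub>M ?M \<rightarrow>\<^sub>M ?M"
    by (intro measurable_PiM_single') (auto simp: space_pair_measure space_PiM split_beta PiE_iff)
  show ?thesis
  proof (rule PiM_eq)
    fix J F assume J: "finite J" "J \<subseteq> (UNIV :: 'i set)" and F: "\<And>j. j \<in> J \<Longrightarrow> F j \<in> sets (N j)"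
    let ?B = "\<lambda>J. prod_emb UNIV N J (\<Pi>\<^sub>E j\<in>J. F j)"
    have B: "?B I \<in> sets ?M" if "I \<subseteq> J" for I
      using that F J by (intro sets_PiM_I) (auto intro: finite_subset)
    have eB: "emeasure ?M (?B I) = (\<Prod>j\<in>I. emeasure (N j) (F j))" if "I \<subseteq> J" for I
    proof (rule emeasure_PiM_emb)
      show "finite I"
        using that J by (rule_tac finite_subset)
      show "F j \<in> sets (N j)" if "j \<in> I" for j
        using that \<open>I \<subseteq> J\<close> F by blast
    qed simp
    have sp: "F j \<subseteq> space (N j)" if "j \<in> J" for j
      using F[OF that] by (rule sets.sets_into_space)
    have "?m -` ?B J \<inter> space (?M \<Otimes>\<^sub>M ?M) = ?B (J \<inter> A) \<times> ?B (J - A)"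
      using sp by (fastforce simp: prod_emb_def space_pair_measure space_PiM PiE_iff split: if_splits)
    then have "emeasure (distr (?M \<Otimes>\<^sub>M ?M) ?M ?m) (?B J) = emeasure ?M (?B (J \<inter> A)) * emeasure ?M (?B (J - A))"
      using B by (simp add: emeasure_distr P.emeasure_pair_measure_Times)
    also have "\<dots> = (\<Prod>j\<in>J \<inter> A. emeasure (N j) (F j)) * (\<Prod>j\<in>J - A. emeasure (N j) (F j))"
      using eB[of "J \<inter> A"] eB[of "J - A"] by simp
    also have "\<dots> = (\<Prod>j\<in>J. emeasure (N j) (F j))"
      using J by (subst prod.union_disjoint[symmetric]) (auto intro!: prod.cong)
    finally show "emeasure (distr (?M \<Otimes>\<^sub>M ?M) ?M ?m) (?B J) = (\<Prod>j\<in>J. emeasure (N j) (F j))" .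
  qed simp
qed

lemma prob_space_uniform: "prob_space (uniform_measure lborel {0..1::real})"
  by (intro prob_space_uniform_measure) auto

lemma emeasure_uniform:
  assumes "A \<in> sets borel"
  shows "emeasure (uniform_measure lborel {0..1::real}) A = emeasure lborel ({0..1} \<inter> A)"
  using assms by (simp add: emeasure_uniform_measure divide_ennreal_def)

lemma prob_space_uniform_source: "prob_space uniform_source"
  unfolding uniform_source_def by (intro prob_space_PiM prob_space_uniform)

interpretation uniform_source: prob_space uniform_source
  by (rule prob_space_uniform_source)

lemma space_uniform_source [simp]: "space uniform_source = UNIV"
  by (simp add: uniform_source_def space_PiM)

lemma measurable_uniform_source [measurable]: "(\<lambda>U. U n) \<in> borel_measurable uniform_source"
  unfolding uniform_source_def by measurable

definition merge_source :: "nat set \<Rightarrow> (nat \<Rightarrow> real) \<Rightarrow> (nat \<Rightarrow> real) \<Rightarrow> nat \<Rightarrow> real" where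
  "merge_source A U V = (\<lambda>i. if i \<in> A then U i else V i)"

lemma measurable_merge_source [measurable]:
  "(\<lambda>(U, V). merge_source A U V) \<in> uniform_source \<Otimes>\<^sub>M uniform_source \<rightarrow>\<^sub>M uniform_source"
proof -
  have "(\<lambda>x. merge_source A (fst x) (snd x) i) \<in> borel_measurable (uniform_source \<Otimes>\<^sub>M uniform_source)" for i
    by (cases "i \<in> A") (simp_all add: merge_source_def)
  then show ?thesis
    by (subst (3) uniform_source_def)
      (auto intro!: measurable_PiM_single'
        simp: split_beta space_PiM measurable_cong_sets[OF refl sets_uniform_measure])
qed

text \<open>Resampling the coordinates outside \<open>A\<close> makes independence a matter of Fubini.\<close>

lemma distr_merge_source:
  "distr (uniform_source \<Otimes>\<^sub>M uniform_source) uniform_source (\<lambda>(U, V). merge_source A U V) = uniform_source"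
  unfolding merge_source_def uniform_source_def
  by (rule distr_merge_PiM) (rule prob_space_uniform)

text \<open>The working form of resampling: the samples numbered by \<open>A\<close> are frozen in
  the outer integral and the others redrawn inside, which replaces conditional expectations.\<close>

lemma emeasure_merge_source:
  assumes [measurable]: "E \<in> sets uniform_source"
  shows "emeasure uniform_source E =
    (\<integral>\<^sup>+U. emeasure uniform_source {V. merge_source A U V \<in> E} \<partial>uniform_source)"
proof -
  let ?M = "uniform_source"
  interpret P2: pair_prob_space ?M ?M ..
  have "emeasure ?M E = emeasure (distr (?M \<Otimes>\<^sub>M ?M) ?M (\<lambda>(U, V). merge_source A U V)) E"
    by (simp add: distr_merge_source)
  also have "\<dots> = emeasure (?M \<Otimes>\<^sub>M ?M) ((\<lambda>(U, V). merge_source A U V) -` E \<inter> space (?M \<Otimes>\<^sub>M ?M))"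
    by (rule emeasure_distr) auto
  also have "\<dots> = (\<integral>\<^sup>+U. emeasure ?M (Pair U -` ((\<lambda>(U, V). merge_source A U V) -` E \<inter> space (?M \<Otimes>\<^sub>M ?M))) \<partial>?M)"
    by (rule uniform_source.emeasure_pair_measure_alt) measurable
  also have "\<dots> = (\<integral>\<^sup>+U. emeasure ?M {V. merge_source A U V \<in> E} \<partial>?M)"
    by (intro nn_integral_cong arg_cong[where f = "emeasure ?M"]) (auto simp: space_pair_measure)
  finally show ?thesis .
qed

text \<open>With \<open>A\<close> frozen, membership in \<open>E\<close> is decided by the outer
  variable and membership in \<open>F\<close> by the inner one, so the inner probability is constant
  on \<open>E\<close> and zero elsewhere.\<close>

lemma prob_Int_disjoint_coordinates:
  assumes [measurable]: "E \<in> sets uniform_source" "F \<in> sets uniform_source"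
    and E: "\<And>U V. (\<forall>i\<in>A. U i = V i) \<Longrightarrow> U \<in> E \<longleftrightarrow> V \<in> E"
    and F: "\<And>U V. (\<forall>i\<in>B. U i = V i) \<Longrightarrow> U \<in> F \<longleftrightarrow> V \<in> F"
    and "A \<inter> B = {}"
  shows "uniform_source.prob (E \<inter> F) = uniform_source.prob E * uniform_source.prob F"
proof -
  have *: "merge_source A U V \<in> E \<longleftrightarrow> U \<in> E" "merge_source A U V \<in> F \<longleftrightarrow> V \<in> F" for U V
    using \<open>A \<inter> B = {}\<close> by (auto intro!: E F simp: merge_source_def)
  have "emeasure uniform_source (E \<inter> F) =
      (\<integral>\<^sup>+U. emeasure uniform_source F * indicator E U \<partial>uniform_source)"
    by (subst emeasure_merge_source[where A = A])
      (auto simp: * indicator_def intro!: nn_integral_cong)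
  then have "emeasure uniform_source (E \<inter> F) = emeasure uniform_source F * emeasure uniform_source E"
    by (simp add: nn_integral_cmult_indicator)
  then show ?thesis
    by (simp add: measure_def enn2real_mult mult.commute)
qed

section \<open>Configurations determined on finite sets\<close>

text \<open>Over finite types the product \<sigma>-algebra is discrete; arbitrary functions of a
  neighbourhood tuple, such as \<open>update\<close> or \<open>deduce\<close>, are therefore
  measurable.\<close>

lemma measurable_count_space_fun:
  fixes g :: "'m::finite \<Rightarrow> 'a \<Rightarrow> 'b::finite"
  assumes "\<And>i. g i \<in> M \<rightarrow>\<^sub>M count_space UNIV"
  shows "(\<lambda>x i. g i x) \<in> M \<rightarrow>\<^sub>M count_space UNIV"
proof -
  have "(\<lambda>x i. g i x) \<in> M \<rightarrow>\<^sub>M Pi\<^sub>M UNIV (\<lambda>_::'m. count_space (UNIV :: 'b set))"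
    using assms by (intro measurable_PiM_single') auto
  also have "Pi\<^sub>M UNIV (\<lambda>_::'m. count_space (UNIV :: 'b set)) = count_space UNIV"
    by (subst count_space_PiM_finite) (auto simp: PiE_UNIV_domain)
  finally show ?thesis .
qed

lemma space_configs [simp]: "space configs = UNIV"
  by (simp add: configs_def space_PiM)

lemma measurable_configs:
  assumes "\<And>k. (\<lambda>x. g x k) \<in> M \<rightarrow>\<^sub>M count_space UNIV"
  shows "g \<in> M \<rightarrow>\<^sub>M configs"
  unfolding configs_def using assms by (intro measurable_PiM_single') auto

lemma measurable_config_apply [measurable]: "(\<lambda>x. x k) \<in> configs \<rightarrow>\<^sub>M count_space UNIV"
  unfolding configs_def by measurable

lemma configs_eqI:
  fixes P Q :: "('d::finite, 's::finite) config measure"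
  assumes "sets P = sets configs" "sets Q = sets configs" "finite_measure P"
    and eq: "\<And>K X. finite K \<Longrightarrow> emeasure P {z. \<forall>k\<in>K. z k \<in> X k} = emeasure Q {z. \<forall>k\<in>K. z k \<in> X k}"
  shows "P = Q"
proof (rule measure_eqI_PiM_infinite)
  fix X :: "int ^ 'd \<Rightarrow> 's set" and K :: "(int ^ 'd) set" assume "finite K"
  have "prod_emb UNIV (\<lambda>_. count_space UNIV) K (Pi\<^sub>E K X) = {z. \<forall>k\<in>K. z k \<in> X k}"
    by (auto simp: prod_emb_def PiE_iff)
  then show "emeasure P (prod_emb UNIV (\<lambda>_. count_space UNIV) K (Pi\<^sub>E K X)) =
      emeasure Q (prod_emb UNIV (\<lambda>_. count_space UNIV) K (Pi\<^sub>E K X))"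
    using eq[OF \<open>finite K\<close>] by simp
qed (use assms in \<open>auto simp: configs_def\<close>)

text \<open>Fixing the symbol at one site of \<open>J\<close> splits \<open>E\<close> into finitely
  many slices, each governed by a set with one site fewer.\<close>

lemma sets_configs_finite_dependence:
  fixes E :: "('d::finite, 's::finite) config set"
  assumes "finite J" and E: "\<And>x y. (\<forall>j\<in>J. x j = y j) \<Longrightarrow> x \<in> E \<longleftrightarrow> y \<in> E"
  shows "E \<in> sets configs"
  using assms
proof (induction J arbitrary: E rule: finite_induct)
  case empty
  then have "E = {} \<or> E = UNIV"
    by (metis UNIV_eq_I empty_iff ex_in_conv)
  then show ?case
    using sets.top[of configs] by auto
next
  case (insert j J)
  have E_eq: "E = (\<Union>b\<in>UNIV. {x \<in> space configs. x j = b} \<inter> {x. x(j := b) \<in> E})"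
    by (auto simp del: fun_upd_apply)
  have "{x. x(j := b) \<in> E} \<in> sets configs" for b
  proof (rule insert.IH)
    fix x y :: "('d, 's) config" assume "\<forall>i\<in>J. x i = y i"
    then have "\<forall>i\<in>insert j J. (x(j := b)) i = (y(j := b)) i"
      by auto
    from insert.prems[OF this] show "x \<in> {x. x(j := b) \<in> E} \<longleftrightarrow> y \<in> {x. x(j := b) \<in> E}"
      unfolding mem_Collect_eq .
  qed
  moreover have "{x \<in> space configs. x j = b} \<in> sets configs" for b
    by measurable
  ultimately have "(\<Union>b\<in>UNIV. {x \<in> space configs. x j = b} \<inter> {x. x(j := b) \<in> E}) \<in> sets configs"
    by (intro sets.finite_UN sets.Int) auto
  then show ?case
    unfolding E_eq[symmetric] .
qed

section \<open>Trajectories driven by the samples\<close>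

text \<open>Intervals of length \<open>c b\<close> are laid side by side from 0, and the one
  containing \<open>u\<close> names the symbol. Successive subtraction uses only operations that
  programs have.\<close>

primrec pick :: "('s \<Rightarrow> real) \<Rightarrow> 's list \<Rightarrow> real \<Rightarrow> 's option" where
  "pick c [] u = None"
| "pick c (b # bs) u = (if u < c b then Some b else pick c bs (u - c b))"

lemma pick_in_set: "pick c bs u = Some b \<Longrightarrow> b \<in> set bs"
  by (induction bs arbitrary: u) (auto split: if_splits)

lemma pick_eq_None_iff:
  assumes "\<And>b. 0 \<le> c b" "0 \<le> u"
  shows "pick c bs u = None \<longleftrightarrow> sum_list (map c bs) \<le> u"
  using \<open>0 \<le> u\<close>
proof (induction bs arbitrary: u)
  case (Cons b bs)
  have "0 \<le> sum_list (map c bs)"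
    using assms(1) by (induction bs) simp_all
  then show ?case
    using Cons.IH[of "u - c b"] Cons.prems by (simp add: le_diff_eq add.commute)
qed simp

lemma measurable_pick [measurable]: "pick c bs \<in> borel \<rightarrow>\<^sub>M count_space UNIV"
proof (induction bs)
  case (Cons b bs)
  have "(\<lambda>u. pick c bs (u - c b)) \<in> borel \<rightarrow>\<^sub>M count_space UNIV"
    by (rule measurable_compose[OF _ Cons]) simp
  then show ?case
    by simp
qed simp

text \<open>Dropping the first interval translates the others by \<open>c a\<close>, and Lebesgue
  measure is translation invariant. The condition \<open>0 \<le> u\<close> excludes the negative
  reals, all of which would be assigned to the first symbol.\<close>

lemma emeasure_pick_Some:
  assumes "distinct bs" "b \<in> set bs" "\<And>b. 0 \<le> c b"
  shows "emeasure lborel {u. 0 \<le> u \<and> pick c bs u = Some b} = ennreal (c b)"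
  using assms(1,2)
proof (induction bs)
  case (Cons a bs)
  show ?case
  proof (cases "b = a")
    case True
    with Cons.prems have "{u. 0 \<le> u \<and> pick c (a # bs) u = Some b} = {0..<c b}"
      by (auto dest: pick_in_set)
    then show ?thesis
      using assms(3) by simp
  next
    case False
    let ?S = "{u. 0 \<le> u \<and> pick c bs u = Some b}"
    have "{u. 0 \<le> u \<and> pick c (a # bs) u = Some b} = (+) (- c a) -` ?S"
      using False order_trans[OF assms(3)[of a]] by (auto simp: not_less split: if_splits)
    moreover have "emeasure lborel ((+) (- c a) -` ?S) = emeasure (distr lborel borel ((+) (- c a))) ?S"
      by (subst emeasure_distr) auto
    ultimately show ?thesis
      using Cons False by (simp add: lborel_distr_plus)
  qed
qed auto

section \<open>Numbering of the space-time cells\<close>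

definition coords :: "int ^ 'd::finite \<Rightarrow> int list" where
  "coords k = map (\<lambda>j. k $ from_nat_into UNIV j) [0..<CARD('d)]"

lemma inj_coords: "inj (coords :: int ^ 'd::finite \<Rightarrow> int list)"
proof (rule injI)
  fix k l :: "int ^ 'd" assume eq: "coords k = coords l"
  have "k $ j = l $ j" for j
  proof -
    have "j \<in> from_nat_into UNIV ` {..<CARD('d)}"
      using bij_betw_from_nat_into_finite[of "UNIV :: 'd set"] by (simp add: bij_betw_def)
    then show ?thesis
      using eq by (auto simp: coords_def)
  qed
  then show "k = l"
    by (simp add: vec_eq_iff)
qed

text \<open>Injective, so different space-time cells own different, hence independent, samples;
  built from encodings that the program can compute. The layer is stored as an integer so that the
  argument is a plain list of integers.\<close>

definition code :: "nat \<Rightarrow> int ^ 'd::finite \<Rightarrow> nat" where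
  "code t k = list_encode (map int_encode (int t # coords k))"

lemma code_eq_iff [simp]: "code t k = code t' k' \<longleftrightarrow> t = t' \<and> k = k'"
  by (simp add: code_def list_encode_eq inj_map_eq_map[OF inj_int_encode] inj_eq[OF inj_coords]
      del: list.map list_encode.simps)

text \<open>The weights \<open>c\<close> are the part of \<phi> that ignores the neighbours; the
  remaining mass \<open>1 - sum c UNIV\<close>, possibly zero, applies \<open>f\<close>.
  \<open>syms\<close> fixes the order of the intervals in \<open>pick\<close>, which proof and
  program must share.\<close>

locale noisy_automaton =
  fixes nb :: "'m::finite \<Rightarrow> int ^ 'd::finite"
    and f :: "('m \<Rightarrow> 's::finite) \<Rightarrow> 's"
    and \<alpha> :: 's
    and c :: "'s \<Rightarrow> real"
    and \<phi> :: "('m \<Rightarrow> 's) \<Rightarrow> 's \<Rightarrow> real"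
    and syms :: "'s list"
  assumes syms: "distinct syms" "set syms = UNIV"
    and c_nonneg: "0 \<le> c b" and sum_c_le: "sum c UNIV \<le> 1" and c_pos: "0 < c \<alpha>"
    and spread: "a i = \<alpha> \<Longrightarrow> f a = \<alpha>"
    and \<phi>_eq: "\<phi> a b = (1 - sum c UNIV) * indicator {f a} b + c b"
begin

lemma stochastic: "stochastic \<phi>"
proof -
  have "(\<Sum>b\<in>UNIV. indicator {a} b :: real) = 1" for a :: 's
    by (simp add: indicator_def)
  then show ?thesis
    using c_nonneg sum_c_le
    by (auto simp: stochastic_def \<phi>_eq sum.distrib simp flip: sum_distrib_left)
qed

lemma c_le: "c b \<le> 1"
  using member_le_sum[of b UNIV c] c_nonneg sum_c_le by fastforce

definition noise :: "real \<Rightarrow> 's option" where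
  "noise = pick c syms"

lemma measurable_noise [measurable]: "noise \<in> borel \<rightarrow>\<^sub>M count_space UNIV"
  unfolding noise_def by measurable

lemma noise_eq_None_iff: "0 \<le> u \<Longrightarrow> noise u = None \<longleftrightarrow> sum c UNIV \<le> u"
  using syms pick_eq_None_iff[of c u syms] c_nonneg
  by (simp add: noise_def sum_list_distinct_conv_sum_set)

lemma emeasure_noise_Some: "emeasure (uniform_measure lborel {0..1}) {u. noise u = Some b} = ennreal (c b)"
proof -
  have "u < 1" if "0 \<le> u" "noise u = Some b" for u
    using noise_eq_None_iff[of u] that sum_c_le by auto
  then have "{0..1} \<inter> {u. noise u = Some b} = {u. 0 \<le> u \<and> pick c syms u = Some b}"
    by (auto simp: noise_def less_imp_le)
  then show ?thesis
    using emeasure_pick_Some[of syms b c] syms c_nonneg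
    by (subst emeasure_uniform) simp_all
qed

lemma emeasure_noise_None:
  "emeasure (uniform_measure lborel {0..1}) {u. noise u = None} = ennreal (1 - sum c UNIV)"
proof -
  have "{0..1} \<inter> {u. noise u = None} = {sum c UNIV..1}"
    using sum_nonneg[of UNIV c] c_nonneg by (auto simp: noise_eq_None_iff intro: order_trans)
  then show ?thesis
    using sum_c_le by (subst emeasure_uniform) simp_all
qed

definition update :: "'s option \<Rightarrow> ('m \<Rightarrow> 's) \<Rightarrow> 's" where
  "update n a = (case n of None \<Rightarrow> f a | Some b \<Rightarrow> b)"

lemma emeasure_update:
  "emeasure (uniform_measure lborel {0..1}) {u. update (noise u) a \<in> X} = (\<Sum>b\<in>X. ennreal (\<phi> a b))"
proof -
  let ?N = "uniform_measure lborel {0..1}"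
  have [measurable]: "{u. noise u = n} \<in> sets ?N" for n
    by simp
  have *: "emeasure ?N {u. update (noise u) a = b} = ennreal (\<phi> a b)" for b
  proof (cases "f a = b")
    case True
    then have "{u. update (noise u) a = b} = {u. noise u = None} \<union> {u. noise u = Some b}"
      by (auto simp: update_def split: option.split_asm)
    moreover have "emeasure ?N ({u. noise u = None} \<union> {u. noise u = Some b}) =
        emeasure ?N {u. noise u = None} + emeasure ?N {u. noise u = Some b}"
      by (intro plus_emeasure[symmetric]) auto
    ultimately show ?thesis
      using True c_nonneg sum_c_le by (simp only: emeasure_noise_None emeasure_noise_Some) (simp add: \<phi>_eq)
  next
    case False
    then have "{u. update (noise u) a = b} = {u. noise u = Some b}"
      by (auto simp: update_def split: option.splits)
    with False show ?thesis
      by (simp add: emeasure_noise_Some \<phi>_eq)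
  qed
  have [measurable]: "{u. update (noise u) a = b} \<in> sets ?N" for b
  proof -
    have "{u. update (noise u) a = b} = (\<Union>n\<in>{n. update n a = b}. {u. noise u = n})"
      by auto
    then show ?thesis
      by (auto intro!: sets.finite_UN)
  qed
  have "{u. update (noise u) a \<in> X} = (\<Union>b\<in>X. {u. update (noise u) a = b})"
    by auto
  then have "emeasure ?N {u. update (noise u) a \<in> X} = (\<Sum>b\<in>X. emeasure ?N {u. update (noise u) a = b})"
    by (subst sum_emeasure) (auto simp: disjoint_family_on_def)
  then show ?thesis
    by (simp add: *)
qed

section \<open>Backward trajectories and the symbols they determine\<close>

abbreviation \<Phi> :: "('d, 's) config \<Rightarrow> ('d, 's) config measure" where
  "\<Phi> \<equiv> pca nb \<phi>"

text \<open>Layers count backwards: layer \<open>t + r\<close> carries the initial configuration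
  \<open>x\<close>, and one update leads from layer \<open>Suc t\<close> to layer
  \<open>t\<close>.\<close>

primrec trajectory :: "('d, 's) config \<Rightarrow> nat \<Rightarrow> (nat \<Rightarrow> real) \<Rightarrow> nat \<Rightarrow> ('d, 's) config" where
  "trajectory x 0 U t k = x k"
| "trajectory x (Suc r) U t k =
    update (noise (U (code t k))) (\<lambda>i. trajectory x r U (Suc t) (k + nb i))"

text \<open>A symbol is deduced from the noise alone: \<open>\<alpha>\<close> spreads even if other neighbours are unknown.\<close>

definition deduce :: "'s option \<Rightarrow> ('m \<Rightarrow> 's option) \<Rightarrow> 's option" where
  "deduce n a = (case n of Some b \<Rightarrow> Some b
    | None \<Rightarrow> if \<exists>i. a i = Some \<alpha> then Some \<alpha>
              else if \<exists>i. a i = None then None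
              else Some (f (\<lambda>i. the (a i))))"

text \<open>The recursion of \<open>trajectory\<close> with the initial configuration replaced by
  total ignorance, so that whatever comes out holds for every start.\<close>

primrec known :: "nat \<Rightarrow> (nat \<Rightarrow> real) \<Rightarrow> nat \<Rightarrow> int ^ 'd \<Rightarrow> 's option" where
  "known 0 U t k = None"
| "known (Suc r) U t k = deduce (noise (U (code t k))) (\<lambda>i. known r U (Suc t) (k + nb i))"

text \<open>Here \<open>a'\<close> is any completion of the partial information \<open>a\<close>.
  Without noise, a known \<alpha> among the neighbours forces \<alpha> by spreading; otherwise
  \<open>a\<close> is total and leaves \<open>a'\<close> no freedom.\<close>

lemma deduce_Some_imp_update:
  assumes "deduce n a = Some b" "\<And>i s. a i = Some s \<Longrightarrow> a' i = s"
  shows "update n a' = b"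
proof (cases n)
  case None
  show ?thesis
  proof (cases "\<exists>i. a i = Some \<alpha>")
    case True
    then show ?thesis
      using assms None spread by (auto simp: deduce_def update_def)
  next
    case False
    then have "\<forall>i. a i \<noteq> None" and b: "b = f (\<lambda>i. the (a i))"
      using assms(1) None by (auto simp: deduce_def split: if_splits)
    then have "a' = (\<lambda>i. the (a i))"
      using assms(2) by fastforce
    with b None show ?thesis
      by (simp add: update_def)
  qed
qed (use assms in \<open>auto simp: deduce_def update_def\<close>)

lemma deduce_mono:
  assumes "deduce n a = Some b" "\<And>i s. a i = Some s \<Longrightarrow> a' i = Some s"
  shows "deduce n a' = Some b"
proof (cases "n = None \<and> \<not> (\<exists>i. a i = Some \<alpha>)")
  case True
  then have "\<forall>i. a i \<noteq> None"
    using assms(1) by (auto simp: deduce_def split: if_splits)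
  then have "a' = a"
    by (intro ext) (metis assms(2) option.exhaust)
  with assms(1) show ?thesis
    by simp
next
  case False
  then show ?thesis
    using assms by (auto simp: deduce_def split: option.splits)
qed

text \<open>The additional layer lies at the far end of the past, where it can only replace
  \<open>None\<close> by a symbol; \<open>deduce_mono\<close> carries this down to layer
  \<open>t\<close>.\<close>

lemma known_Suc: "known r U t k = Some b \<Longrightarrow> known (Suc r) U t k = Some b"
proof (induction r arbitrary: t k b)
  case (Suc r)
  from Suc.prems have "deduce (noise (U (code t k))) (\<lambda>i. known r U (Suc t) (k + nb i)) = Some b"
    by simp
  then have "deduce (noise (U (code t k))) (\<lambda>i. known (Suc r) U (Suc t) (k + nb i)) = Some b"
    by (rule deduce_mono) (rule Suc.IH)
  then show ?case
    by (simp only: known.simps)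
qed simp

lemma known_mono:
  assumes "r \<le> r'" "known r U t k = Some b"
  shows "known r' U t k = Some b"
  using assms by (induction rule: dec_induct) (auto intro: known_Suc simp del: known.simps)

lemma known_imp_trajectory: "known r U t k = Some b \<Longrightarrow> trajectory x r U t k = b"
proof (induction r arbitrary: t k b)
  case (Suc r)
  from Suc.prems have "deduce (noise (U (code t k))) (\<lambda>i. known r U (Suc t) (k + nb i)) = Some b"
    by simp
  then have "update (noise (U (code t k))) (\<lambda>i. trajectory x r U (Suc t) (k + nb i)) = b"
    by (rule deduce_Some_imp_update) (rule Suc.IH)
  then show ?case
    by simp
qed simp

lemma known_cong:
  assumes "\<And>t' (l :: int ^ 'd). t \<le> t' \<Longrightarrow> U (code t' l) = V (code t' l)"
  shows "known r U t k = known r V t k"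
  using assms
proof (induction r arbitrary: t k)
  case (Suc r)
  have "known r U (Suc t) l = known r V (Suc t) l" for l
    by (rule Suc.IH) (auto intro: Suc.prems)
  then show ?case
    using Suc.prems by simp
qed simp

text \<open>Displacements, over all layers together, of the cells whose samples a trajectory of
  depth \<open>r\<close> reads. Depth 0 consults only the initial configuration, hence the empty
  set.\<close>

primrec reach :: "nat \<Rightarrow> (int ^ 'd) set" where
  "reach 0 = {}"
| "reach (Suc r) = insert 0 (\<Union>i. (+) (nb i) ` reach r)"

lemma finite_reach: "finite (reach r)"
  by (induction r) auto

lemma trajectory_cong:
  assumes "\<And>t' e. t \<le> t' \<Longrightarrow> e \<in> reach r \<Longrightarrow> U (code t' (k + e)) = V (code t' (k + e))"
  shows "trajectory x r U t k = trajectory x r V t k"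
  using assms
proof (induction r arbitrary: t k)
  case (Suc r)
  have "trajectory x r U (Suc t) (k + nb i) = trajectory x r V (Suc t) (k + nb i)" for i
  proof (rule Suc.IH)
    fix t' e assume "Suc t \<le> t'" "e \<in> reach r"
    then show "U (code t' (k + nb i + e)) = V (code t' (k + nb i + e))"
      using Suc.prems[of t' "nb i + e"] by (auto simp: add.assoc)
  qed
  moreover have "U (code t k) = V (code t k)"
    using Suc.prems[of t 0] by simp
  ultimately show ?case
    by simp
qed simp

section \<open>Measurability and laws of trajectories\<close>

lemma measurable_trajectory [measurable]:
  "(\<lambda>U. trajectory x r U t k) \<in> uniform_source \<rightarrow>\<^sub>M count_space UNIV"
proof (induction r arbitrary: t k)
  case (Suc r)
  have "(\<lambda>U i. trajectory x r U (Suc t) (k + nb i)) \<in> uniform_source \<rightarrow>\<^sub>M count_space UNIV"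
    by (rule measurable_count_space_fun) (rule Suc)
  then have "(\<lambda>U. update n (\<lambda>i. trajectory x r U (Suc t) (k + nb i))) \<in> uniform_source \<rightarrow>\<^sub>M count_space UNIV" for n
    by (rule measurable_compose) simp
  then show ?case
    unfolding trajectory.simps
    by (rule measurable_compose_countable'[where I = UNIV and
        f = "\<lambda>n U. update n (\<lambda>i. trajectory x r U (Suc t) (k + nb i))"]) (auto intro: uncountable_infinite)
qed simp

lemma measurable_known [measurable]:
  "(\<lambda>U. known r U t k) \<in> uniform_source \<rightarrow>\<^sub>M count_space UNIV"
proof (induction r arbitrary: t k)
  case (Suc r)
  have "(\<lambda>U i. known r U (Suc t) (k + nb i)) \<in> uniform_source \<rightarrow>\<^sub>M count_space UNIV"
    by (rule measurable_count_space_fun) (rule Suc)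
  then have "(\<lambda>U. deduce n (\<lambda>i. known r U (Suc t) (k + nb i))) \<in> uniform_source \<rightarrow>\<^sub>M count_space UNIV" for n
    by (rule measurable_compose) simp
  then show ?case
    unfolding known.simps
    by (rule measurable_compose_countable'[where I = UNIV and
        f = "\<lambda>n U. deduce n (\<lambda>i. known r U (Suc t) (k + nb i))"]) (auto intro: uncountable_infinite)
qed simp

lemma measurable_update_config:
  assumes [measurable]: "Y \<in> uniform_source \<rightarrow>\<^sub>M configs"
  shows "(\<lambda>U k. update (noise (U (code t k))) (\<lambda>i. Y U (k + nb i))) \<in> uniform_source \<rightarrow>\<^sub>M configs"
proof (rule measurable_configs)
  fix k
  have "(\<lambda>U i. Y U (k + nb i)) \<in> uniform_source \<rightarrow>\<^sub>M count_space UNIV"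
    by (rule measurable_count_space_fun) measurable
  then have "(\<lambda>U. update n (\<lambda>i. Y U (k + nb i))) \<in> uniform_source \<rightarrow>\<^sub>M count_space UNIV" for n
    by (rule measurable_compose) simp
  then show "(\<lambda>U. update (noise (U (code t k))) (\<lambda>i. Y U (k + nb i))) \<in> uniform_source \<rightarrow>\<^sub>M count_space UNIV"
    by (rule measurable_compose_countable'[where I = UNIV and
        f = "\<lambda>n U. update n (\<lambda>i. Y U (k + nb i))"]) (auto intro: uncountable_infinite)
qed

text \<open>For a frozen \<open>y\<close> the new symbols read pairwise different samples, hence are
  independent, and \<open>emeasure_update\<close> gives their individual laws.\<close>

lemma distr_update_const:
  "distr uniform_source configs (\<lambda>U k. update (noise (U (code t k))) (\<lambda>i. y (k + nb i))) = \<Phi> y"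
proof (rule configs_eqI)
  fix K :: "(int ^ 'd) set" and X :: "int ^ 'd \<Rightarrow> 's set" assume K: "finite K"
  let ?N = "uniform_measure lborel {0..1::real}"
  let ?B = "\<lambda>k. {u. update (noise u) (\<lambda>i. y (k + nb i)) \<in> X k}"
  interpret product_prob_space "\<lambda>_::nat. ?N" UNIV
    by (intro product_prob_spaceI prob_space_uniform)
  \<comment> \<open>The product formula is indexed by sample numbers, so the cell has to be
    recovered from its number.\<close>
  define site where "site = inv (code t :: int ^ 'd \<Rightarrow> nat)"
  have site [simp]: "site (code t k) = k" for k
    unfolding site_def by (rule inv_f_f) (simp add: inj_def)
  have B: "?B k \<in> sets ?N" for k
  proof -
    have "?B k = noise -` {n. update n (\<lambda>i. y (k + nb i)) \<in> X k} \<inter> space borel"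
      by auto
    also have "\<dots> \<in> sets borel"
      by (rule measurable_sets[OF measurable_noise]) simp
    finally show ?thesis
      by simp
  qed
  have sets: "{z. \<forall>k\<in>K. z k \<in> X k} \<in> sets configs"
    by (rule sets_configs_finite_dependence[OF K]) auto
  have "emeasure (distr uniform_source configs (\<lambda>U k. update (noise (U (code t k))) (\<lambda>i. y (k + nb i))))
        {z. \<forall>k\<in>K. z k \<in> X k} =
      emeasure uniform_source {U \<in> space (Pi\<^sub>M UNIV (\<lambda>_::nat. ?N)). \<forall>n\<in>code t ` K. U n \<in> ?B (site n)}"
    using sets by (subst emeasure_distr)
      (auto intro!: measurable_update_config arg_cong[where f = "emeasure uniform_source"] simp: space_PiM)
  also have "\<dots> = (\<Prod>n\<in>code t ` K. emeasure ?N (?B (site n)))"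
    unfolding uniform_source_def by (rule emeasure_PiM_Collect) (use K B in auto)
  also have "\<dots> = (\<Prod>k\<in>K. \<Sum>b\<in>X k. ennreal (\<phi> (\<lambda>i. y (k + nb i)) b))"
    by (subst prod.reindex) (auto simp: inj_on_def emeasure_update)
  also have "\<dots> = emeasure (\<Phi> y) {z. \<forall>k\<in>K. z k \<in> X k}"
    by (rule emeasure_pca_box[OF stochastic K, symmetric])
  finally show "emeasure (distr uniform_source configs (\<lambda>U k. update (noise (U (code t k))) (\<lambda>i. y (k + nb i))))
        {z. \<forall>k\<in>K. z k \<in> X k} = emeasure (\<Phi> y) {z. \<forall>k\<in>K. z k \<in> X k}" .
next
  show "finite_measure (distr uniform_source configs (\<lambda>U k. update (noise (U (code t k))) (\<lambda>i. y (k + nb i))))"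
    by (intro prob_space.finite_measure uniform_source.prob_space_distr measurable_update_config) simp
qed (simp_all add: sets_pca)

text \<open>Markov property: since \<open>Y\<close> does not read layer \<open>t\<close>, redrawing
  that layer leaves \<open>Y U\<close> fixed, and \<open>distr_update_const\<close> applies under
  the integral.\<close>

lemma distr_update:
  assumes Y [measurable]: "Y \<in> uniform_source \<rightarrow>\<^sub>M configs"
    and past: "\<And>U V. (\<And>n. n \<notin> range (code t :: int ^ 'd \<Rightarrow> nat) \<Longrightarrow> U n = V n) \<Longrightarrow> Y U = Y V"
  shows "distr uniform_source configs (\<lambda>U k. update (noise (U (code t k))) (\<lambda>i. Y U (k + nb i)))
    = distr uniform_source configs Y \<bind> \<Phi>"
proof (rule measure_eqI)
  have kernel: "\<Phi> \<in> configs \<rightarrow>\<^sub>M subprob_algebra configs"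
    by (intro measurable_prob_algebraD measurable_pca stochastic)
  have [measurable]: "(\<lambda>U k. update (noise (U (code t k))) (\<lambda>i. Y U (k + nb i))) \<in> uniform_source \<rightarrow>\<^sub>M configs"
    by (rule measurable_update_config) fact
  show "sets (distr uniform_source configs (\<lambda>U k. update (noise (U (code t k))) (\<lambda>i. Y U (k + nb i)))) =
      sets (distr uniform_source configs Y \<bind> \<Phi>)"
    by (subst sets_bind[where N = configs]) (auto simp: sets_pca)
  fix E assume "E \<in> sets (distr uniform_source configs (\<lambda>U k. update (noise (U (code t k))) (\<lambda>i. Y U (k + nb i))))"
  then have E [measurable]: "E \<in> sets configs"
    by simp
  let ?A = "- range (code t :: int ^ 'd \<Rightarrow> nat)"
  have "emeasure (distr uniform_source configs (\<lambda>U k. update (noise (U (code t k))) (\<lambda>i. Y U (k + nb i)))) E =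
      emeasure uniform_source {U \<in> space uniform_source. (\<lambda>k. update (noise (U (code t k))) (\<lambda>i. Y U (k + nb i))) \<in> E}"
    by (subst emeasure_distr) (auto intro!: arg_cong[where f = "emeasure uniform_source"])
  also have "\<dots> = (\<integral>\<^sup>+U. emeasure uniform_source {V. (\<lambda>k. update (noise (V (code t k))) (\<lambda>i. Y U (k + nb i))) \<in> E} \<partial>uniform_source)"
  proof (subst emeasure_merge_source[where A = ?A], measurable, rule nn_integral_cong)
    fix U :: "nat \<Rightarrow> real"
    have "Y (merge_source ?A U V) = Y U" for V
      by (rule past) (simp add: merge_source_def)
    then show "emeasure uniform_source {V. merge_source ?A U V \<in> {U \<in> space uniform_source.
          (\<lambda>k. update (noise (U (code t k))) (\<lambda>i. Y U (k + nb i))) \<in> E}} =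
        emeasure uniform_source {V. (\<lambda>k. update (noise (V (code t k))) (\<lambda>i. Y U (k + nb i))) \<in> E}"
      by (simp add: merge_source_def)
  qed
  also have "\<dots> = (\<integral>\<^sup>+U. emeasure (\<Phi> (Y U)) E \<partial>uniform_source)"
  proof (rule nn_integral_cong)
    fix U :: "nat \<Rightarrow> real"
    show "emeasure uniform_source {V. (\<lambda>k. update (noise (V (code t k))) (\<lambda>i. Y U (k + nb i))) \<in> E} = emeasure (\<Phi> (Y U)) E"
      unfolding distr_update_const[of t "Y U", symmetric]
      by (subst emeasure_distr[OF measurable_update_config]) (auto intro!: arg_cong[where f = "emeasure uniform_source"])
  qed
  also have "\<dots> = (\<integral>\<^sup>+y. emeasure (\<Phi> y) E \<partial>distr uniform_source configs Y)"
    by (subst nn_integral_distr) (auto intro!: measurable_emeasure_kernel[OF kernel])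
  also have "\<dots> = emeasure (distr uniform_source configs Y \<bind> \<Phi>) E"
    by (rule emeasure_bind[symmetric]) (auto intro: measurable_prob_algebraD measurable_pca stochastic)
  finally show "emeasure (distr uniform_source configs (\<lambda>U k. update (noise (U (code t k))) (\<lambda>i. Y U (k + nb i)))) E =
      emeasure (distr uniform_source configs Y \<bind> \<Phi>) E" .
qed

text \<open>The layer \<open>t\<close> is generalised because the preceding configuration lives one
  layer further back; the law itself does not depend on it.\<close>

lemma distr_trajectory:
  "distr uniform_source configs (\<lambda>U. trajectory x r U t) = kernel_pow \<Phi> r x"
proof (induction r arbitrary: t)
  case 0
  have "(\<lambda>U. trajectory x 0 U t) = (\<lambda>U. x)"
    by (simp add: fun_eq_iff)
  then show ?case
    by simp
next
  case (Suc r)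
  have "(\<lambda>U. trajectory x (Suc r) U t) =
      (\<lambda>U k. update (noise (U (code t k))) (\<lambda>i. trajectory x r U (Suc t) (k + nb i)))"
    by (simp add: fun_eq_iff)
  moreover have "distr uniform_source configs \<dots> = distr uniform_source configs (\<lambda>U. trajectory x r U (Suc t)) \<bind> \<Phi>"
  proof (rule distr_update)
    show "(\<lambda>U. trajectory x r U (Suc t)) \<in> uniform_source \<rightarrow>\<^sub>M configs"
      by (intro measurable_configs measurable_trajectory)
    show "trajectory x r U (Suc t) = trajectory x r V (Suc t)"
      if "\<And>n. n \<notin> range (code t :: int ^ 'd \<Rightarrow> nat) \<Longrightarrow> U n = V n" for U V
    proof (intro ext trajectory_cong)
      fix k :: "int ^ 'd" and t' e assume "Suc t \<le> t'"
      then have "code t' (k + e) \<notin> range (code t :: int ^ 'd \<Rightarrow> nat)"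
        by auto
      then show "U (code t' (k + e)) = V (code t' (k + e))"
        by (rule that)
    qed
  qed
  ultimately show ?case
    using Suc by simp
qed

lemma prob_noise_ne: "emeasure uniform_source {U. noise (U n) \<noteq> Some \<alpha>} = ennreal (1 - c \<alpha>)"
proof -
  let ?N = "uniform_measure lborel {0..1::real}"
  interpret N: prob_space ?N
    by (rule prob_space_uniform)
  interpret product_prob_space "\<lambda>_::nat. ?N" UNIV
    by (intro product_prob_spaceI prob_space_uniform)
  have S: "{u. noise u = Some \<alpha>} \<in> sets ?N"
    by simp
  have "emeasure uniform_source {U. noise (U n) \<noteq> Some \<alpha>} =
      emeasure uniform_source {U \<in> space (Pi\<^sub>M UNIV (\<lambda>_::nat. ?N)). U n \<in> space ?N - {u. noise u = Some \<alpha>}}"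
    by (simp add: space_PiM)
  also have "\<dots> = emeasure ?N (space ?N - {u. noise u = Some \<alpha>})"
    unfolding uniform_source_def by (rule emeasure_PiM_Collect_single) (use S in auto)
  also have "\<dots> = 1 - ennreal (c \<alpha>)"
    using S emeasure_noise_Some[of \<alpha>] by (subst emeasure_compl) (auto simp: N.emeasure_space_1)
  finally show ?thesis
    using ennreal_minus[OF c_nonneg[of \<alpha>], of 1] by simp
qed

subsection \<open>Exponential decay of the undetermined set\<close>

text \<open>For a single cell this just says that its symbol is unknown. For larger sets the first
  condition is essential: one cell known to carry \<alpha> settles the set, which keeps the bound
  below free of \<open>card K\<close>.\<close>

definition undecided :: "nat \<Rightarrow> nat \<Rightarrow> (int ^ 'd) set \<Rightarrow> (nat \<Rightarrow> real) set" where
  "undecided r t K = {U. (\<forall>k\<in>K. known r U t k \<noteq> Some \<alpha>) \<and> (\<exists>k\<in>K. known r U t k = None)}"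

lemma sets_undecided [measurable]:
  assumes "finite K"
  shows "undecided r t K \<in> sets uniform_source"
proof -
  have "{U \<in> space uniform_source. (\<forall>k\<in>K. known r U t k \<noteq> Some \<alpha>) \<and> (\<exists>k\<in>K. known r U t k = None)} \<in> sets uniform_source"
    using assms by measurable
  then show ?thesis
    by (simp add: undecided_def)
qed

text \<open>
  An undecided set stays undecided in the next layer only through its noiseless cells, all of whose
  neighbours then avoid \<open>\<alpha>\<close>; in particular no cell of the current layer is hit by \<open>\<alpha>\<close>-noise.
\<close>

lemma emeasure_undecided_le:
  "finite K \<Longrightarrow> emeasure uniform_source (undecided r t K) \<le> ennreal ((1 - c \<alpha>) ^ r)"
proof (induction r arbitrary: t K)
  case 0
  show ?case
    by (simp add: uniform_source.emeasure_le_1)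
next
  case (Suc r)
  show ?case
  proof (cases "K = {}")
    case True
    then show ?thesis
      by (simp add: undecided_def)
  next
    case False
    \<comment> \<open>A single cell, chosen in advance, suffices to gain the factor
      \<open>1 - c \<alpha>\<close> in this layer.\<close>
    then obtain k0 where k0: "k0 \<in> K"
      by blast
    let ?A = "range (code t :: int ^ 'd \<Rightarrow> nat)"
    \<comment> \<open>The set passed on to the next layer is random but depends on layer
      \<open>t\<close> alone; once that layer is frozen, the induction hypothesis for arbitrary
      finite sets applies.\<close>
    let ?K = "\<lambda>U. (\<lambda>(k, i). k + nb i) ` ({k\<in>K. noise (U (code t k)) = None} \<times> UNIV)"
    have step: "noise (U (code t k0)) \<noteq> Some \<alpha> \<and> V \<in> undecided r (Suc t) (?K U)"
      if und: "merge_source ?A U V \<in> undecided (Suc r) t K" for U V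
    proof -
      have "known r (merge_source ?A U V) (Suc t) l = known r V (Suc t) l" for l
        by (rule known_cong) (auto simp: merge_source_def)
      then have eq: "known (Suc r) (merge_source ?A U V) t k =
          deduce (noise (U (code t k))) (\<lambda>i. known r V (Suc t) (k + nb i))" for k
        by (simp add: merge_source_def)
      have ne: "deduce (noise (U (code t k))) (\<lambda>i. known r V (Suc t) (k + nb i)) \<noteq> Some \<alpha>" if "k \<in> K" for k
        using und that by (auto simp: undecided_def eq simp del: known.simps)
      have "noise (U (code t k0)) \<noteq> Some \<alpha>"
        using ne[OF k0] by (auto simp: deduce_def)
      moreover have "known r V (Suc t) (k + nb i) \<noteq> Some \<alpha>" if "k \<in> K" "noise (U (code t k)) = None" for k i
        using ne[of k] that by (auto simp: deduce_def split: if_splits)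
      moreover obtain k where "k \<in> K" "deduce (noise (U (code t k))) (\<lambda>i. known r V (Suc t) (k + nb i)) = None"
        using und by (auto simp: undecided_def eq simp del: known.simps)
      then have "noise (U (code t k)) = None \<and> (\<exists>i. known r V (Suc t) (k + nb i) = None)"
        by (auto simp: deduce_def split: option.splits if_splits)
      ultimately show ?thesis
        using \<open>k \<in> K\<close> by (fastforce simp: undecided_def)
    qed
    have meas: "{U. noise (U (code t k0)) \<noteq> Some \<alpha>} \<in> sets uniform_source"
    proof -
      have "(\<lambda>U. noise (U (code t k0))) \<in> uniform_source \<rightarrow>\<^sub>M count_space UNIV"
        by measurable
      from measurable_sets[OF this, of "- {Some \<alpha>}"] show ?thesis
        by (simp add: vimage_def)
    qed
    have "emeasure uniform_source {V. merge_source ?A U V \<in> undecided (Suc r) t K} \<le>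
        ennreal ((1 - c \<alpha>) ^ r) * indicator {U. noise (U (code t k0)) \<noteq> Some \<alpha>} U" for U
    proof (cases "noise (U (code t k0)) = Some \<alpha>")
      case True
      then have "{V. merge_source ?A U V \<in> undecided (Suc r) t K} = {}"
        using step by blast
      then show ?thesis
        by simp
    next
      case False
      have "emeasure uniform_source {V. merge_source ?A U V \<in> undecided (Suc r) t K} \<le>
          emeasure uniform_source (undecided r (Suc t) (?K U))"
        using step Suc.prems by (intro emeasure_mono sets_undecided) auto
      also have "\<dots> \<le> ennreal ((1 - c \<alpha>) ^ r)"
        using Suc.prems by (intro Suc.IH) auto
      finally show ?thesis
        using False by simp
    qed
    then have "emeasure uniform_source (undecided (Suc r) t K) \<le>
        (\<integral>\<^sup>+U. ennreal ((1 - c \<alpha>) ^ r) * indicator {U. noise (U (code t k0)) \<noteq> Some \<alpha>} U \<partial>uniform_source)"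
      by (subst emeasure_merge_source[where A = ?A])
        (auto intro!: nn_integral_mono sets_undecided Suc.prems)
    also have "\<dots> = ennreal ((1 - c \<alpha>) ^ r) * emeasure uniform_source {U \<in> space uniform_source. noise (U (code t k0)) \<noteq> Some \<alpha>}"
      by (subst nn_integral_cmult_indicator[symmetric]) (simp_all add: meas)
    also have "\<dots> = ennreal ((1 - c \<alpha>) ^ r) * ennreal (1 - c \<alpha>)"
      by (simp add: prob_noise_ne)
    also have "\<dots> = ennreal ((1 - c \<alpha>) ^ Suc r)"
      using c_le[of \<alpha>] by (simp add: ennreal_mult[symmetric] mult.commute)
    finally show ?thesis .
  qed
qed

lemma prob_unknown_le: "uniform_source.prob {U. known r U t k = None} \<le> (1 - c \<alpha>) ^ r"
proof -
  have "undecided r t {k} = {U. known r U t k = None}"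
    by (auto simp: undecided_def)
  then have "emeasure uniform_source {U. known r U t k = None} \<le> ennreal ((1 - c \<alpha>) ^ r)"
    using emeasure_undecided_le[of "{k}" r t] by simp
  then show ?thesis
    using c_le[of \<alpha>] by (simp add: uniform_source.emeasure_eq_measure)
qed

end

section \<open>Ergodicity and mixing\<close>

text \<open>The coupling inequality: \<open>C\<close> contains every outcome on which the two events
  disagree.\<close>

lemma (in prob_space) abs_prob_diff_le:
  assumes "A \<in> events" "B \<in> events" "C \<in> events" "A \<subseteq> B \<union> C" "B \<subseteq> A \<union> C"
  shows "\<bar>prob A - prob B\<bar> \<le> prob C"
proof -
  have "prob A \<le> prob (B \<union> C)" "prob B \<le> prob (A \<union> C)"
    using assms by (auto intro!: finite_measure_mono)
  moreover have "prob (B \<union> C) \<le> prob B + prob C" "prob (A \<union> C) \<le> prob A + prob C"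
    using assms by (auto intro!: measure_Un_le)
  ultimately show ?thesis
    by linarith
qed

lemma configs_eqI_measure:
  fixes P Q :: "('d::finite, 's::finite) config measure"
  assumes "prob_space P" "prob_space Q" "sets P = sets configs" "sets Q = sets configs"
    and eq: "\<And>J E. finite J \<Longrightarrow> (\<And>x y. (\<forall>j\<in>J. x j = y j) \<Longrightarrow> x \<in> E \<longleftrightarrow> y \<in> E) \<Longrightarrow> measure P E = measure Q E"
  shows "P = Q"
proof (rule configs_eqI)
  interpret P: prob_space P by fact
  interpret Q: prob_space Q by fact
  show "finite_measure P"
    using assms(1) by (rule prob_space.finite_measure)
  show "emeasure P {z. \<forall>k\<in>K. z k \<in> X k} = emeasure Q {z. \<forall>k\<in>K. z k \<in> X k}" if "finite K" for K X
    using eq[OF that, of "{z. \<forall>k\<in>K. z k \<in> X k}"] by (simp add: P.emeasure_eq_measure Q.emeasure_eq_measure)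
qed (use assms in auto)

lemma measurable_shift [measurable]: "shift k \<in> configs \<rightarrow>\<^sub>M configs"
  unfolding shift_def by (rule measurable_configs) measurable

text \<open>Shifting moves cells and their neighbourhoods alike, and the local rule is the same at
  all sites. Together with uniqueness this makes the invariant measure shift invariant.\<close>

lemma pca_shift:
  fixes nb :: "'m::finite \<Rightarrow> int ^ 'd::finite" and \<phi> :: "('m \<Rightarrow> 's::finite) \<Rightarrow> 's \<Rightarrow> real"
  assumes "stochastic \<phi>"
  shows "pca nb \<phi> (shift k x) = distr (pca nb \<phi> x) configs (shift k)"
proof (rule configs_eqI)
  fix K :: "(int ^ 'd) set" and X :: "int ^ 'd \<Rightarrow> 's set" assume K: "finite K"
  have [measurable]: "shift k \<in> pca nb \<phi> x \<rightarrow>\<^sub>M configs"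
    using measurable_shift[of k] by (simp add: measurable_cong_sets[OF sets_pca refl])
  have space: "space (pca nb \<phi> x) = UNIV"
    using sets_eq_imp_space_eq[OF sets_pca, of nb \<phi> x] by simp
  have "emeasure (distr (pca nb \<phi> x) configs (shift k)) {z. \<forall>j\<in>K. z j \<in> X j} =
      emeasure (pca nb \<phi> x) (shift k -` {z. \<forall>j\<in>K. z j \<in> X j} \<inter> space (pca nb \<phi> x))"
    by (rule emeasure_distr) (auto intro: sets_configs_finite_dependence[OF K])
  also have "shift k -` {z. \<forall>j\<in>K. z j \<in> X j} \<inter> space (pca nb \<phi> x) = {z. \<forall>j\<in>(+) k ` K. z j \<in> X (j - k)}"
    by (auto simp: shift_def space)
  also have "emeasure (pca nb \<phi> x) \<dots> = (\<Prod>j\<in>K. \<Sum>b\<in>X j. ennreal (\<phi> (\<lambda>i. shift k x (j + nb i)) b))"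
    using K assms by (subst emeasure_pca_box) (auto simp: prod.reindex shift_def add.assoc)
  also have "\<dots> = emeasure (pca nb \<phi> (shift k x)) {z. \<forall>j\<in>K. z j \<in> X j}"
    by (rule emeasure_pca_box[OF assms K, symmetric])
  finally show "emeasure (pca nb \<phi> (shift k x)) {z. \<forall>j\<in>K. z j \<in> X j} =
      emeasure (distr (pca nb \<phi> x) configs (shift k)) {z. \<forall>j\<in>K. z j \<in> X j}" ..
qed (auto simp: sets_pca intro: prob_space.finite_measure prob_space_pca assms)

lemma cyl_cong: "\<forall>j\<in>K. x j = y j \<Longrightarrow> x \<in> cyl K u \<longleftrightarrow> y \<in> cyl K u"
  by (auto simp: cyl_def)

context noisy_automaton
begin

section \<open>Kernel powers and invariant measures\<close>

lemma measurable_kernel: "\<Phi> \<in> configs \<rightarrow>\<^sub>M prob_algebra configs"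
  by (rule measurable_pca) (rule stochastic)

lemma measurable_kernel_pow: "kernel_pow \<Phi> r \<in> configs \<rightarrow>\<^sub>M prob_algebra configs"
proof (induction r)
  case 0
  then show ?case
    by (simp add: measurable_return_prob_space)
next
  case (Suc r)
  then show ?case
    unfolding kernel_pow.simps by (intro measurable_bind_prob_space[OF _ measurable_kernel])
qed

lemma invariant_kernel_pow:
  assumes "invariant_measure \<Phi> \<pi>"
  shows "\<pi> \<bind> kernel_pow \<Phi> r = \<pi>"
proof (induction r)
  case 0
  have "kernel_pow \<Phi> 0 = return configs"
    by (simp add: fun_eq_iff)
  then show ?case
    using assms by (simp add: invariant_measure_def space_prob_algebra bind_return'')
next
  case (Suc r)
  have "kernel_pow \<Phi> (Suc r) = (\<lambda>x. kernel_pow \<Phi> r x \<bind> \<Phi>)"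
    by (simp add: fun_eq_iff)
  then have "\<pi> \<bind> kernel_pow \<Phi> (Suc r) = \<pi> \<bind> (\<lambda>x. kernel_pow \<Phi> r x \<bind> \<Phi>)"
    by simp
  also have "\<dots> = \<pi> \<bind> kernel_pow \<Phi> r \<bind> \<Phi>"
    using assms
    by (intro bind_assoc[symmetric, where N = configs and R = configs])
      (auto simp: invariant_measure_def space_prob_algebra measurable_cong_sets[of \<pi> configs]
        intro: measurable_prob_algebraD measurable_kernel measurable_kernel_pow)
  also have "\<dots> = \<pi>"
    using Suc assms by (simp add: invariant_measure_def)
  finally show ?case .
qed

text \<open>All sufficient depths yield the same symbol, and the least one merely makes a choice;
  \<alpha> is a default on the null event that no depth suffices. The layer stays a parameter so
  that successive layers can be related.\<close>

definition limit :: "(nat \<Rightarrow> real) \<Rightarrow> nat \<Rightarrow> ('d, 's) config" where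
  "limit U t k =
     (if \<exists>r. known r U t k \<noteq> None then the (known (LEAST r. known r U t k \<noteq> None) U t k) else \<alpha>)"

lemma known_imp_limit:
  assumes "known r U t k = Some b"
  shows "limit U t k = b"
proof -
  let ?r = "LEAST r. known r U t k \<noteq> None"
  have "known ?r U t k \<noteq> None" "?r \<le> r"
    using LeastI[of "\<lambda>r. known r U t k \<noteq> None" r] Least_le[of "\<lambda>r. known r U t k \<noteq> None" r] assms
    by simp_all
  then have "known ?r U t k = Some b"
    using assms known_mono[of ?r r U t k] by fastforce
  then show ?thesis
    using assms by (auto simp: limit_def)
qed

lemma limit_cong:
  assumes "\<And>t' (l :: int ^ 'd). t \<le> t' \<Longrightarrow> U (code t' l) = V (code t' l)"
  shows "limit U t k = limit V t k"
proof -
  have "known r U t k = known r V t k" for r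
    by (rule known_cong) (rule assms)
  then show ?thesis
    by (simp add: limit_def)
qed

lemma measurable_limit [measurable]:
  "(\<lambda>U. limit U t k) \<in> uniform_source \<rightarrow>\<^sub>M count_space UNIV"
proof -
  have "{U \<in> space uniform_source. limit U t k = b} \<in> sets uniform_source" for b
  proof -
    have "limit U t k = b \<longleftrightarrow> (\<exists>r. known r U t k = Some b) \<or> b = \<alpha> \<and> (\<forall>r. known r U t k = None)" for U
    proof (cases "\<exists>r. known r U t k \<noteq> None")
      case True
      then obtain r s where "known r U t k = Some s"
        by auto
      then show ?thesis
        using known_imp_limit by fastforce
    qed (auto simp: limit_def)
    moreover have "{U \<in> space uniform_source. (\<exists>r. known r U t k = Some b) \<or> b = \<alpha> \<and> (\<forall>r. known r U t k = None)}
        \<in> sets uniform_source"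
      by measurable
    ultimately show ?thesis
      by simp
  qed
  then show ?thesis
    by (subst measurable_count_space_eq2) (auto simp: vimage_def)
qed

lemma measurable_limit_config [measurable]: "(\<lambda>U. limit U t) \<in> uniform_source \<rightarrow>\<^sub>M configs"
  by (rule measurable_configs) (rule measurable_limit)

lemma rate_tendsto: "(\<lambda>r. C * (1 - c \<alpha>) ^ r) \<longlonglongrightarrow> 0"
  using c_pos c_le[of \<alpha>] by (intro tendsto_mult_right_zero LIMSEQ_realpow_zero) auto

lemma AE_known: "AE U in uniform_source. \<forall>k. \<exists>r. known r U t k \<noteq> None"
proof (subst AE_all_countable, rule allI)
  fix k
  let ?N = "{U \<in> space uniform_source. \<forall>r. known r U t k = None}"
  have N: "?N \<in> sets uniform_source"
    by measurable
  have "uniform_source.prob ?N \<le> (1 - c \<alpha>) ^ r" for r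
  proof -
    have "{U \<in> space uniform_source. known r U t k = None} \<in> sets uniform_source"
      by measurable
    then have "uniform_source.prob ?N \<le> uniform_source.prob {U. known r U t k = None}"
      by (intro uniform_source.finite_measure_mono) auto
    with prob_unknown_le[of r t k] show ?thesis
      by simp
  qed
  then have "uniform_source.prob ?N \<le> 0"
    using rate_tendsto[of 1] by (intro LIMSEQ_le_const) auto
  then have "uniform_source.prob ?N = 0"
    by (simp add: measure_le_0_iff)
  then have "emeasure uniform_source ?N = 0"
    by (simp add: uniform_source.emeasure_eq_measure)
  then show "AE U in uniform_source. \<exists>r. known r U t k \<noteq> None"
    using N by (intro AE_I[where N = ?N]) auto
qed

lemma AE_limit_update:
  "AE U in uniform_source. limit U t = (\<lambda>k. update (noise (U (code t k))) (\<lambda>i. limit U (Suc t) (k + nb i)))"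
  using AE_known[of t]
proof eventually_elim
  case (elim U)
  show ?case
  proof
    fix k
    obtain r b where r: "known r U t k = Some b"
      using elim by blast
    \<comment> \<open>Raising the depth by one exhibits the symbol as a deduction from the
      neighbours at depth \<open>r\<close>. \<open>limit\<close> completes these partial data, so
      its default at unknown neighbours does no harm.\<close>
    then have "known (Suc r) U t k = Some b"
      by (rule known_Suc)
    then have "update (noise (U (code t k))) (\<lambda>i. limit U (Suc t) (k + nb i)) = b"
      by (intro deduce_Some_imp_update[where a = "\<lambda>i. known r U (Suc t) (k + nb i)"]) (auto intro: known_imp_limit)
    then show "limit U t k = update (noise (U (code t k))) (\<lambda>i. limit U (Suc t) (k + nb i))"
      using known_imp_limit[OF r] by simp
  qed
qed

section \<open>Invariance, uniqueness and uniform convergence\<close>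

definition limit_law :: "nat \<Rightarrow> ('d, 's) config measure" where
  "limit_law t = distr uniform_source configs (\<lambda>U. limit U t)"

lemma sets_limit_law [simp]: "sets (limit_law t) = sets configs"
  by (simp add: limit_law_def)

lemma prob_space_limit_law: "prob_space (limit_law t)"
  unfolding limit_law_def by (rule uniform_source.prob_space_distr) measurable

text \<open>Only half of invariance: the kernel carries the law of one layer to that of the next.
  That the two laws coincide is shown separately.\<close>

lemma limit_law_Suc: "limit_law t = limit_law (Suc t) \<bind> \<Phi>"
proof -
  have "limit_law t =
      distr uniform_source configs (\<lambda>U k. update (noise (U (code t k))) (\<lambda>i. limit U (Suc t) (k + nb i)))"
    unfolding limit_law_def
    by (rule distr_cong_AE) (auto intro!: AE_limit_update measurable_update_config measurable_limit_config)
  also have "\<dots> = limit_law (Suc t) \<bind> \<Phi>"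
    unfolding limit_law_def
  proof (rule distr_update)
    show "limit U (Suc t) = limit V (Suc t)"
      if "\<And>n. n \<notin> range (code t :: int ^ 'd \<Rightarrow> nat) \<Longrightarrow> U n = V n" for U V
    proof (intro ext limit_cong)
      fix t' and l :: "int ^ 'd" assume "Suc t \<le> t'"
      then have "code t' l \<notin> range (code t :: int ^ 'd \<Rightarrow> nat)"
        by auto
      then show "U (code t' l) = V (code t' l)"
        by (rule that)
    qed
  qed measurable
  finally show ?thesis .
qed

text \<open>Trajectory and limit are built from the same samples and can differ at \<open>j\<close>
  only if \<open>j\<close> is unknown at depth \<open>r\<close>; a union bound over \<open>J\<close>
  gives the factor \<open>card J\<close>. The bound is free of \<open>x\<close>, whence
  uniformity.\<close>

lemma kernel_pow_close:
  assumes J: "finite J" and E: "\<And>x y. (\<forall>j\<in>J. x j = y j) \<Longrightarrow> x \<in> E \<longleftrightarrow> y \<in> E"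
  shows "\<bar>measure (kernel_pow \<Phi> r x) E - measure (limit_law t) E\<bar> \<le> card J * (1 - c \<alpha>) ^ r"
proof -
  let ?A = "{U \<in> space uniform_source. trajectory x r U t \<in> E}"
  let ?B = "{U \<in> space uniform_source. limit U t \<in> E}"
  let ?C = "\<lambda>j. {U \<in> space uniform_source. known r U t j = None}"
  have [measurable]: "E \<in> sets configs"
    by (rule sets_configs_finite_dependence[OF J E])
  have [measurable]: "(\<lambda>U. trajectory x r U t) \<in> uniform_source \<rightarrow>\<^sub>M configs"
    by (intro measurable_configs measurable_trajectory)
  have agree: "trajectory x r U t \<in> E \<longleftrightarrow> limit U t \<in> E" if "\<forall>j\<in>J. known r U t j \<noteq> None" for U
  proof (rule E, rule ballI)
    fix j assume "j \<in> J"
    with that obtain b where "known r U t j = Some b"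
      by auto
    then show "trajectory x r U t j = limit U t j"
      using known_imp_trajectory[of r U t j b x] known_imp_limit[of r U t j b] by simp
  qed
  have C: "?C j \<in> sets uniform_source" for j
    by measurable
  have "measure (kernel_pow \<Phi> r x) E = uniform_source.prob ?A"
    unfolding distr_trajectory[of x r t, symmetric]
    by (subst measure_distr) (auto intro!: arg_cong[where f = "uniform_source.prob"])
  moreover have "measure (limit_law t) E = uniform_source.prob ?B"
    unfolding limit_law_def
    by (subst measure_distr) (auto intro!: arg_cong[where f = "uniform_source.prob"])
  moreover have "\<bar>uniform_source.prob ?A - uniform_source.prob ?B\<bar> \<le> uniform_source.prob (\<Union>j\<in>J. ?C j)"
    using agree J C by (intro uniform_source.abs_prob_diff_le sets.finite_UN) (measurable, auto)
  moreover have "uniform_source.prob (\<Union>j\<in>J. ?C j) \<le> (\<Sum>j\<in>J. uniform_source.prob (?C j))"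
    using C J by (intro uniform_source.finite_measure_subadditive_finite) auto
  moreover have "\<dots> \<le> (\<Sum>j\<in>J. (1 - c \<alpha>) ^ r)"
    using prob_unknown_le by (intro sum_mono) simp
  ultimately show ?thesis
    by simp
qed

lemma eq_if_close:
  fixes a b :: real
  assumes "\<And>r. \<bar>a - b\<bar> \<le> C * (1 - c \<alpha>) ^ r"
  shows "a = b"
proof -
  have "\<bar>a - b\<bar> \<le> 0"
    using assms rate_tendsto[of C] by (intro LIMSEQ_le_const) auto
  then show ?thesis
    by simp
qed

text \<open>Both laws are approximated by the same \<open>kernel_pow \<Phi> r undefined\<close>, in
  which no layer occurs; \<open>undefined\<close> serves as an arbitrary initial
  configuration.\<close>

lemma limit_law_eq: "limit_law t = limit_law t'"
proof (rule configs_eqI_measure)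
  fix J and E :: "('d, 's) config set"
  assume JE: "finite J" "\<And>x y. (\<forall>j\<in>J. x j = y j) \<Longrightarrow> x \<in> E \<longleftrightarrow> y \<in> E"
  show "measure (limit_law t) E = measure (limit_law t') E"
  proof (rule eq_if_close)
    fix r
    show "\<bar>measure (limit_law t) E - measure (limit_law t') E\<bar> \<le> (2 * card J) * (1 - c \<alpha>) ^ r"
      using kernel_pow_close[OF JE, of r undefined t] kernel_pow_close[OF JE, of r undefined t']
      by simp
  qed
qed (simp_all add: prob_space_limit_law)

lemma invariant_limit_law: "invariant_measure \<Phi> (limit_law t)"
  using limit_law_Suc[of t] limit_law_eq[of "Suc t" t] prob_space_limit_law[of t]
  by (simp add: invariant_measure_def space_prob_algebra)

text \<open>By invariance \<pi> averages \<open>kernel_pow \<Phi> r x\<close> over \<open>x\<close>,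
  and each of these is close to the limit law with an error independent of \<open>x\<close>.\<close>

lemma invariant_eq_limit_law:
  assumes inv: "invariant_measure \<Phi> \<pi>"
  shows "\<pi> = limit_law t"
proof (rule configs_eqI_measure)
  have sets: "sets \<pi> = sets configs" and prob: "prob_space \<pi>"
    using inv by (auto simp: invariant_measure_def space_prob_algebra)
  interpret \<pi>: prob_space \<pi> by fact
  show "prob_space \<pi>" "sets \<pi> = sets configs"
    by fact+
  fix J and E :: "('d, 's) config set"
  assume JE: "finite J" "\<And>x y. (\<forall>j\<in>J. x j = y j) \<Longrightarrow> x \<in> E \<longleftrightarrow> y \<in> E"
  then have E: "E \<in> sets configs"
    by (rule sets_configs_finite_dependence)
  show "measure \<pi> E = measure (limit_law t) E"
  proof (rule eq_if_close)
    fix r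
    let ?d = "card J * (1 - c \<alpha>) ^ r"
    have kernel: "kernel_pow \<Phi> r \<in> \<pi> \<rightarrow>\<^sub>M subprob_algebra configs"
      using measurable_prob_algebraD[OF measurable_kernel_pow[of r]]
      by (simp add: measurable_cong_sets[OF sets refl])
    then have [measurable]: "(\<lambda>x. measure (kernel_pow \<Phi> r x) E) \<in> borel_measurable \<pi>"
      by (rule measurable_compose[OF _ measurable_measure_subprob_algebra]) fact
    have "measure (kernel_pow \<Phi> r x) E \<le> 1" for x
      unfolding distr_trajectory[of x r 0, symmetric]
      by (intro prob_space.prob_le_1 uniform_source.prob_space_distr measurable_configs measurable_trajectory)
    then have int: "integrable \<pi> (\<lambda>x. measure (kernel_pow \<Phi> r x) E)"
      by (intro \<pi>.integrable_const_bound[where B = 1]) auto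
    have "measure \<pi> E = (\<integral>x. measure (kernel_pow \<Phi> r x) E \<partial>\<pi>)"
      using \<pi>.measure_bind[OF kernel E] invariant_kernel_pow[OF inv, of r] by simp
    moreover have "(\<integral>x. measure (kernel_pow \<Phi> r x) E \<partial>\<pi>) \<le> measure (limit_law t) E + ?d"
      using kernel_pow_close[OF JE, of r _ t] by (intro \<pi>.integral_le_const int AE_I2) (simp add: abs_le_iff algebra_simps)
    moreover have "measure (limit_law t) E - ?d \<le> (\<integral>x. measure (kernel_pow \<Phi> r x) E \<partial>\<pi>)"
      using kernel_pow_close[OF JE, of r _ t] by (intro \<pi>.integral_ge_const int AE_I2) (simp add: abs_le_iff algebra_simps)
    ultimately show "\<bar>measure \<pi> E - measure (limit_law t) E\<bar> \<le> ?d"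
      by linarith
  qed
qed (simp_all add: prob_space_limit_law)

lemma uniformly_ergodic: "uniformly_ergodic \<Phi>"
  unfolding uniformly_ergodic_def
proof (intro exI[of _ "limit_law 0"] conjI allI impI)
  show "invariant_measure \<Phi> (limit_law 0)"
    by (rule invariant_limit_law)
  show "\<pi> = limit_law 0" if "invariant_measure \<Phi> \<pi>" for \<pi>
    using that by (rule invariant_eq_limit_law)
  fix K :: "(int ^ 'd) set" and u :: "int ^ 'd \<Rightarrow> 's" assume K: "finite K"
  show "uniform_limit UNIV (\<lambda>t x. measure (kernel_pow \<Phi> t x) (cyl K u)) (\<lambda>x. measure (limit_law 0) (cyl K u)) sequentially"
  proof (rule uniform_limitI)
    fix e :: real assume "0 < e"
    with rate_tendsto[of "card K"] have "\<forall>\<^sub>F r in sequentially. card K * (1 - c \<alpha>) ^ r < e"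
      by (rule order_tendstoD)
    then show "\<forall>\<^sub>F r in sequentially. \<forall>x\<in>UNIV. dist (measure (kernel_pow \<Phi> r x) (cyl K u)) (measure (limit_law 0) (cyl K u)) < e"
    proof eventually_elim
      case (elim r)
      have "\<bar>measure (kernel_pow \<Phi> r x) (cyl K u) - measure (limit_law 0) (cyl K u)\<bar> \<le> card K * (1 - c \<alpha>) ^ r" for x
        using K by (rule kernel_pow_close) (rule cyl_cong)
      with elim show ?case
        by (auto simp: dist_real_def intro: le_less_trans)
    qed
  qed
qed

section \<open>Shift invariance and spatial mixing\<close>

lemma limit_law_shift: "distr (limit_law t) configs (shift k) = limit_law t"
proof (rule invariant_eq_limit_law)
  interpret P: prob_space "limit_law t"
    by (rule prob_space_limit_law)
  have [measurable]: "shift k \<in> limit_law t \<rightarrow>\<^sub>M configs"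
    using measurable_shift[of k] by (simp add: measurable_cong_sets[OF sets_limit_law refl])
  have kernel: "\<Phi> \<in> configs \<rightarrow>\<^sub>M subprob_algebra configs"
    by (intro measurable_prob_algebraD measurable_kernel)
  then have kernel': "\<Phi> \<in> limit_law t \<rightarrow>\<^sub>M subprob_algebra configs"
    by (simp add: measurable_cong_sets[OF sets_limit_law refl])
  \<comment> \<open>The kernel commutes with shifts, so the shifted law is again invariant, and
    uniqueness identifies it.\<close>
  have "distr (limit_law t) configs (shift k) \<bind> \<Phi> = limit_law t \<bind> (\<lambda>x. \<Phi> (shift k x))"
    by (rule bind_distr[OF _ kernel]) (auto simp: P.not_empty)
  also have "\<dots> = limit_law t \<bind> (\<lambda>x. distr (\<Phi> x) configs (shift k))"
    by (simp add: pca_shift[OF stochastic])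
  also have "\<dots> = distr (limit_law t \<bind> \<Phi>) configs (shift k)"
    by (rule distr_bind[OF kernel', symmetric]) (auto simp: P.not_empty)
  also have "limit_law t \<bind> \<Phi> = limit_law t"
    using invariant_limit_law[of t] by (simp add: invariant_measure_def)
  finally show "invariant_measure \<Phi> (distr (limit_law t) configs (shift k))"
    by (simp add: invariant_measure_def space_prob_algebra P.prob_space_distr)
qed

text \<open>The excluded \<open>k\<close> are those for which the sites read for \<open>K\<close>
  and those read for the shifted \<open>L\<close> overlap. For all others the two events read
  disjoint sets of samples.\<close>

lemma kernel_pow_independent:
  assumes "finite K" "finite L"
    and k: "k \<notin> (\<lambda>(a, e, l, e'). a + e - l - e') ` (K \<times> reach r \<times> L \<times> reach r)"
  shows "measure (kernel_pow \<Phi> r x) (cyl K u \<inter> shift k -` cyl L v) =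
    measure (kernel_pow \<Phi> r x) (cyl K u) * measure (kernel_pow \<Phi> r x) (shift k -` cyl L v)"
proof -
  let ?E = "{U. trajectory x r U 0 \<in> cyl K u}" and ?F = "{U. trajectory x r U 0 \<in> shift k -` cyl L v}"
  let ?A = "(\<lambda>(t, a, e). code t (a + e)) ` (UNIV \<times> K \<times> reach r)"
  let ?B = "(\<lambda>(t, l, e). code t (k + l + e)) ` (UNIV \<times> L \<times> reach r)"
  have traj [measurable]: "(\<lambda>U. trajectory x r U 0) \<in> uniform_source \<rightarrow>\<^sub>M configs"
    by (intro measurable_configs measurable_trajectory)
  have cyl [measurable]: "cyl K u \<in> sets configs" "cyl L v \<in> sets configs"
    using assms by (auto intro: sets_configs_finite_dependence[OF _ cyl_cong])
  have shift [measurable]: "shift k -` cyl L v \<in> sets configs"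
    using measurable_sets[OF measurable_shift cyl(2), of k] by simp
  have *: "measure (kernel_pow \<Phi> r x) S = uniform_source.prob {U. trajectory x r U 0 \<in> S}"
    if "S \<in> sets configs" for S
    unfolding distr_trajectory[of x r 0, symmetric]
    using that by (subst measure_distr) (auto simp: vimage_def)
  have "uniform_source.prob (?E \<inter> ?F) = uniform_source.prob ?E * uniform_source.prob ?F"
  proof (rule prob_Int_disjoint_coordinates[where A = ?A and B = ?B])
    show "?E \<in> sets uniform_source" "?F \<in> sets uniform_source"
      using measurable_sets[OF traj cyl(1)] measurable_sets[OF traj shift] by (simp_all add: vimage_def)
    show "U \<in> ?E \<longleftrightarrow> V \<in> ?E" if "\<forall>n\<in>?A. U n = V n" for U V
    proof -
      have "trajectory x r U 0 a = trajectory x r V 0 a" if "a \<in> K" for a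
        using that \<open>\<forall>n\<in>?A. U n = V n\<close> by (intro trajectory_cong) force
      then show ?thesis
        by (auto simp: cyl_def)
    qed
    show "U \<in> ?F \<longleftrightarrow> V \<in> ?F" if "\<forall>n\<in>?B. U n = V n" for U V
    proof -
      have "trajectory x r U 0 (k + l) = trajectory x r V 0 (k + l)" if "l \<in> L" for l
        using that \<open>\<forall>n\<in>?B. U n = V n\<close> by (intro trajectory_cong) force
      then show ?thesis
        by (auto simp: cyl_def shift_def)
    qed
    show "?A \<inter> ?B = {}"
    proof (rule equals0I)
      fix n assume "n \<in> ?A \<inter> ?B"
      then obtain a e l e' where *: "a \<in> K" "e \<in> reach r" "l \<in> L" "e' \<in> reach r" "a + e = k + l + e'"
        by auto
      then have "k = a + e - l - e'"
        by (simp add: algebra_simps)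
      with * k show False
        by force
    qed
  qed
  then show ?thesis
    using cyl(1) shift by (simp add: * Collect_conj_eq[symmetric] sets.Int)
qed

lemma spatially_mixing: "spatially_mixing (limit_law 0)"
  unfolding spatially_mixing_def
proof (intro allI impI tendstoI)
  fix K L :: "(int ^ 'd) set" and u v :: "int ^ 'd \<Rightarrow> 's" and e :: real
  assume K: "finite K" and L: "finite L" and "0 < e"
  let ?\<pi> = "measure (limit_law 0)" and ?C = "real (card K + card L)"
  \<comment> \<open>The 3 counts one error for the intersection and two for the product. The depth
    can be chosen before \<open>k\<close> because shifting \<open>L\<close> keeps its
    cardinality.\<close>
  have "\<forall>\<^sub>F r in sequentially. (3 * ?C) * (1 - c \<alpha>) ^ r < e"
    using rate_tendsto \<open>0 < e\<close> by (rule order_tendstoD)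
  then obtain r where r: "(3 * ?C) * (1 - c \<alpha>) ^ r < e"
    by (auto simp: eventually_sequentially)
  let ?\<kappa> = "measure (kernel_pow \<Phi> r undefined)"
  define d where "d = ?C * (1 - c \<alpha>) ^ r"
  have close: "\<bar>?\<kappa> E - ?\<pi> E\<bar> \<le> d"
    if "finite J" "card J \<le> card K + card L" "\<And>x y. (\<forall>j\<in>J. x j = y j) \<Longrightarrow> x \<in> E \<longleftrightarrow> y \<in> E"
    for J and E :: "('d, 's) config set"
  proof -
    have "card J * (1 - c \<alpha>) ^ r \<le> d"
      unfolding d_def using that(2) c_le[of \<alpha>] by (intro mult_right_mono) auto
    with kernel_pow_close[OF that(1,3), of r undefined 0] show ?thesis
      by linarith
  qed
  have prod: "\<bar>a * b - a' * b'\<bar> \<le> \<bar>a - a'\<bar> + \<bar>b - b'\<bar>"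
    if "0 \<le> b" "b \<le> 1" "0 \<le> a'" "a' \<le> 1" for a b a' b' :: real
  proof -
    have "a * b - a' * b' = (a - a') * b + a' * (b - b')"
      by (simp add: algebra_simps)
    also have "\<bar>\<dots>\<bar> \<le> \<bar>a - a'\<bar> * b + a' * \<bar>b - b'\<bar>"
      using that by (metis abs_mult abs_of_nonneg abs_triangle_ineq)
    also have "\<dots> \<le> \<bar>a - a'\<bar> * 1 + 1 * \<bar>b - b'\<bar>"
      using that by (intro add_mono mult_left_mono mult_right_mono) auto
    finally show ?thesis
      by simp
  qed
  interpret \<pi>: prob_space "limit_law 0"
    by (rule prob_space_limit_law)
  interpret \<kappa>: prob_space "kernel_pow \<Phi> r undefined"
    unfolding distr_trajectory[of undefined r 0, symmetric]
    by (intro uniform_source.prob_space_distr measurable_configs measurable_trajectory)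
  have "\<forall>\<^sub>F k in cofinite. k \<notin> (\<lambda>(a, e, l, e'). a + e - l - e') ` (K \<times> reach r \<times> L \<times> reach r)"
    using K L finite_reach by (auto simp: eventually_cofinite)
  then show "\<forall>\<^sub>F k in cofinite. dist (?\<pi> (cyl K u \<inter> shift k -` cyl L v)) (?\<pi> (cyl K u) * ?\<pi> (cyl L v)) < e"
  proof eventually_elim
    case (elim k)
    let ?S = "shift k -` cyl L v"
    have card: "card ((+) k ` L) = card L"
      by (rule card_image) (auto simp: inj_on_def)
    have "\<bar>?\<kappa> (cyl K u \<inter> ?S) - ?\<pi> (cyl K u \<inter> ?S)\<bar> \<le> d"
    proof (rule close[of "K \<union> (+) k ` L"])
      show "card (K \<union> (+) k ` L) \<le> card K + card L"
        using card_Un_le[of K "(+) k ` L"] card by simp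
    qed (use K L in \<open>auto simp: cyl_def shift_def\<close>)
    moreover have "\<bar>?\<kappa> (cyl K u) - ?\<pi> (cyl K u)\<bar> \<le> d"
      by (rule close[of K]) (use K in \<open>auto simp: cyl_def\<close>)
    moreover have "\<bar>?\<kappa> ?S - ?\<pi> ?S\<bar> \<le> d"
      by (rule close[of "(+) k ` L"]) (use L card in \<open>auto simp: cyl_def shift_def\<close>)
    moreover have \<pi>_S: "?\<pi> ?S = ?\<pi> (cyl L v)"
    proof -
      have "cyl L v \<in> sets configs"
        using L by (rule sets_configs_finite_dependence[OF _ cyl_cong])
      moreover have "space (limit_law 0) = UNIV"
        using sets_eq_imp_space_eq[OF sets_limit_law, of 0] by simp
      moreover have "shift k \<in> limit_law 0 \<rightarrow>\<^sub>M configs"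
        using measurable_shift[of k] by (simp add: measurable_cong_sets[OF sets_limit_law refl])
      ultimately have "measure (distr (limit_law 0) configs (shift k)) (cyl L v) = ?\<pi> ?S"
        by (subst measure_distr) auto
      then show ?thesis
        by (simp add: limit_law_shift)
    qed
    moreover have "\<bar>?\<kappa> (cyl K u) * ?\<kappa> ?S - ?\<pi> (cyl K u) * ?\<pi> (cyl L v)\<bar> \<le>
        \<bar>?\<kappa> (cyl K u) - ?\<pi> (cyl K u)\<bar> + \<bar>?\<kappa> ?S - ?\<pi> ?S\<bar>"
      unfolding \<pi>_S by (rule prod) auto
    moreover have "?\<kappa> (cyl K u \<inter> ?S) = ?\<kappa> (cyl K u) * ?\<kappa> ?S"
      by (rule kernel_pow_independent[OF K L elim])
    moreover have "3 * d < e"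
      using r by (simp add: d_def algebra_simps)
    ultimately show ?case
      unfolding dist_real_def by linarith
  qed
qed

end

section \<open>The sampling program\<close>

lemma eval_VarI: "i < length env \<Longrightarrow> v = env ! i \<Longrightarrow> eval P \<phi> U env (Var i) v"
  by (simp add: eval_eval_list.Var)

lemma eval_IntConstI: "v = VNum (of_int z) \<Longrightarrow> eval P \<phi> U env (IntConst z) v"
  by (simp add: eval_eval_list.IntConst)

lemma eval_ArithI:
  "eval P \<phi> U env e1 (VNum r) \<Longrightarrow> eval P \<phi> U env e2 (VNum s) \<Longrightarrow> v = VNum (arith opr r s) \<Longrightarrow>
    eval P \<phi> U env (Arith opr e1 e2) v"
  by (simp add: eval_eval_list.Arith)

lemma eval_IfEqI:
  "eval P \<phi> U env e1 v \<Longrightarrow> eval P \<phi> U env e2 w \<Longrightarrow> (v = w \<Longrightarrow> eval P \<phi> U env e3 z) \<Longrightarrow>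
    (v \<noteq> w \<Longrightarrow> eval P \<phi> U env e4 z) \<Longrightarrow> eval P \<phi> U env (IfEq e1 e2 e3 e4) z"
  by (rule eval_eval_list.IfEq) auto

lemma eval_IfLessI:
  "eval P \<phi> U env e1 (VNum r) \<Longrightarrow> eval P \<phi> U env e2 (VNum s) \<Longrightarrow> (r < s \<Longrightarrow> eval P \<phi> U env e3 z) \<Longrightarrow>
    (\<not> r < s \<Longrightarrow> eval P \<phi> U env e4 z) \<Longrightarrow> eval P \<phi> U env (IfLess e1 e2 e3 e4) z"
  by (rule eval_eval_list.IfLess) auto

lemma val_of_list_simps [simp]:
  "val_of_list [] = VNil"
  "val_of_list (v # vs) = VCons v (val_of_list vs)"
  by (simp_all add: val_of_list_def)

lemma val_of_list_eq_iff [simp]: "val_of_list vs = val_of_list ws \<longleftrightarrow> vs = ws"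
proof (induction vs arbitrary: ws)
  case Nil
  then show ?case
    by (cases ws) auto
next
  case (Cons v vs)
  then show ?case
    by (cases ws) auto
qed

lemma val_of_list_neq_VNum [simp]: "val_of_list vs \<noteq> VNum r"
  by (cases vs) auto

section \<open>Arithmetic on sites and sample numbers\<close>

abbreviation val_of_ints :: "int list \<Rightarrow> 's val" where
  "val_of_ints zs \<equiv> val_of_list (map (\<lambda>z. VNum (of_int z)) zs)"

lemma encode_site_eq: "encode_site k = val_of_ints (coords k)"
  by (simp add: encode_site_def coords_def comp_def)

lemma length_coords [simp]: "length (coords (k :: int ^ 'd::finite)) = CARD('d)"
  by (simp add: coords_def)

lemma coords_add: "coords (k + l) = map2 (+) (coords k) (coords l)"
  by (simp add: coords_def zip_map_map zip_same_conv_map)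

text \<open>\<open>int_encode\<close> interleaves the signs: \<open>2 * z\<close> for nonnegative
  and \<open>- 1 - 2 * z\<close> for negative \<open>z\<close>.\<close>

definition int_code_expr :: "('m, 's) expr \<Rightarrow> ('m, 's) expr" where
  "int_code_expr e = IfLess e (IntConst 0)
     (Arith Minus (IntConst (- 1)) (Arith Times (IntConst 2) e)) (Arith Times (IntConst 2) e)"

lemma eval_int_code_expr:
  assumes "eval P \<phi> U env e (VNum (of_int z))"
  shows "eval P \<phi> U env (int_code_expr e) (VNum (of_nat (int_encode z)))"
  unfolding int_code_expr_def
proof (rule eval_IfLessI[OF assms eval_IntConstI[OF refl]])
  have double: "eval P \<phi> U env (Arith Times (IntConst 2) e) (VNum (2 * of_int z))"
    by (rule eval_ArithI[OF eval_IntConstI[OF refl] assms]) simp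
  show "eval P \<phi> U env (Arith Minus (IntConst (- 1)) (Arith Times (IntConst 2) e)) (VNum (of_nat (int_encode z)))"
    if "real_of_int z < real_of_int 0"
    by (rule eval_ArithI[OF eval_IntConstI[OF refl] double])
      (use that in \<open>simp add: int_encode_def sum_encode_def\<close>)
  show "eval P \<phi> U env (Arith Times (IntConst 2) e) (VNum (of_nat (int_encode z)))"
    if "\<not> real_of_int z < real_of_int 0"
    using double that by (simp add: int_encode_def sum_encode_def)
qed

text \<open>Cantor's pairing function: the triangular number of the sum plus the first
  component.\<close>

definition pair_code_expr :: "('m, 's) expr \<Rightarrow> ('m, 's) expr \<Rightarrow> ('m, 's) expr" where
  "pair_code_expr e1 e2 = Arith Plus
     (Arith Divide (Arith Times (Arith Plus e1 e2) (Arith Plus (Arith Plus e1 e2) (IntConst 1))) (IntConst 2)) e1"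

lemma real_triangle: "real (triangle n) = real n * (real n + 1) / 2"
proof -
  have "2 * triangle n = n * Suc n"
    by (simp add: triangle_def)
  then have "real (2 * triangle n) = real (n * Suc n)"
    by presburger
  then show ?thesis
    by (simp add: algebra_simps)
qed

lemma eval_pair_code_expr:
  assumes "eval P \<phi> U env e1 (VNum (of_nat m))" "eval P \<phi> U env e2 (VNum (of_nat n))"
  shows "eval P \<phi> U env (pair_code_expr e1 e2) (VNum (of_nat (prod_encode (m, n))))"
proof -
  have sum: "eval P \<phi> U env (Arith Plus e1 e2) (VNum (of_nat (m + n)))"
    by (rule eval_ArithI[OF assms]) simp
  have "eval P \<phi> U env (Arith Plus (Arith Plus e1 e2) (IntConst 1)) (VNum (of_nat (m + n) + 1))"
    by (rule eval_ArithI[OF sum eval_IntConstI[OF refl]]) simp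
  note product = eval_ArithI[OF sum this refl, of Times]
  note quotient = eval_ArithI[OF product eval_IntConstI[OF refl] refl, of Divide 2]
  show ?thesis
    unfolding pair_code_expr_def
    by (rule eval_ArithI[OF quotient assms(1)]) (simp add: prod_encode_def real_triangle)
qed

text \<open>The recursion equations of \<open>list_encode\<close>; 4 is the position that this body
  itself occupies in the program.\<close>

definition list_code_expr :: "('m, 's) expr" where
  "list_code_expr = IfEq (Var 0) expr.Nil (IntConst 0)
     (Arith Plus (IntConst 1) (pair_code_expr (int_code_expr (Head (Var 0))) (Call 4 [Tail (Var 0)])))"

lemma eval_list_code_expr:
  assumes P: "4 < length P" "P ! 4 = list_code_expr"
  shows "eval P \<phi> U [val_of_ints zs] list_code_expr (VNum (of_nat (list_encode (map int_encode zs))))"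
proof (induction zs)
  case Nil
  then show ?case
    unfolding list_code_expr_def
    by (rule eval_IfEqI[OF eval_VarI[OF _ refl] eval_eval_list.Nil]) (auto intro: eval_IntConstI)
next
  case (Cons z zs)
  have var: "eval P \<phi> U [val_of_ints (z # zs)] (Var 0) (VCons (VNum (of_int z)) (val_of_ints zs))"
    by (rule eval_VarI) auto
  have "eval P \<phi> U [val_of_ints (z # zs)] (Call 4 [Tail (Var 0)]) (VNum (of_nat (list_encode (map int_encode zs))))"
    using P Cons by (intro eval_eval_list.Call[where vs = "[val_of_ints zs]"]
        eval_eval_list.List_Cons eval_eval_list.List_Nil eval_eval_list.Tail[OF var]) auto
  then have "eval P \<phi> U [val_of_ints (z # zs)]
      (pair_code_expr (int_code_expr (Head (Var 0))) (Call 4 [Tail (Var 0)]))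
      (VNum (of_nat (prod_encode (int_encode z, list_encode (map int_encode zs)))))"
    by (intro eval_pair_code_expr eval_int_code_expr eval_eval_list.Head[OF var])
  then show ?case
    unfolding list_code_expr_def
    by (intro eval_IfEqI[OF var eval_eval_list.Nil] eval_ArithI eval_IntConstI) auto
qed

text \<open>Since the dimension is fixed, adding a constant vector is unrolled instead of being a
  recursive function.\<close>

primrec translate_expr :: "int list \<Rightarrow> ('m, 's) expr \<Rightarrow> ('m, 's) expr" where
  "translate_expr [] e = expr.Nil"
| "translate_expr (z # zs) e = expr.Cons (Arith Plus (Head e) (IntConst z)) (translate_expr zs (Tail e))"

lemma eval_translate_expr:
  "length xs = length zs \<Longrightarrow> eval P \<phi> U env e (val_of_ints xs) \<Longrightarrow>
    eval P \<phi> U env (translate_expr zs e) (val_of_ints (map2 (+) xs zs))"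
proof (induction xs zs arbitrary: e rule: list_induct2)
  case Nil
  then show ?case
    by (simp add: eval_eval_list.Nil)
next
  case (Cons x xs z zs)
  then have e: "eval P \<phi> U env e (VCons (VNum (of_int x)) (val_of_ints xs))"
    by simp
  have "eval P \<phi> U env (Arith Plus (Head e) (IntConst z)) (VNum (of_int (x + z)))"
    by (rule eval_ArithI[OF eval_eval_list.Head[OF e] eval_IntConstI[OF refl]]) simp
  then show ?case
    using Cons.IH[OF eval_eval_list.Tail[OF e]] by (simp add: eval_eval_list.Cons)
qed

section \<open>Decision trees for the noise and the local rule\<close>

primrec pick_expr :: "('s \<Rightarrow> ('m, 's) expr) \<Rightarrow> 's list \<Rightarrow> ('m, 's) expr \<Rightarrow> ('m, 's) expr \<Rightarrow> ('m, 's) expr" where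
  "pick_expr p [] e d = d"
| "pick_expr p (b # bs) e d = IfLess e (p b) (SymConst b) (pick_expr p bs (Arith Minus e (p b)) d)"

text \<open>The default \<open>d\<close>, which will hold the recursive exploration, is evaluated
  only if no noise symbol is picked, so its value is demanded in that case alone.\<close>

lemma eval_pick_expr:
  assumes p: "\<And>b. eval P \<phi> U env (p b) (VNum (c b))"
    and "eval P \<phi> U env e (VNum u)"
    and "pick c bs u = None \<Longrightarrow> eval P \<phi> U env d z"
    and "\<And>b. pick c bs u = Some b \<Longrightarrow> z = VSym b"
  shows "eval P \<phi> U env (pick_expr p bs e d) z"
  using assms(2-4)
proof (induction bs arbitrary: e u)
  case (Cons b bs)
  show ?case
    unfolding pick_expr.simps
  proof (rule eval_IfLessI[OF Cons.prems(1) p])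
    assume "u < c b"
    with Cons.prems(3) have "z = VSym b"
      by simp
    then show "eval P \<phi> U env (SymConst b) z"
      by (simp add: eval_eval_list.SymConst)
  next
    assume "\<not> u < c b"
    with Cons.prems show "eval P \<phi> U env (pick_expr p bs (Arith Minus e (p b)) d) z"
      by (intro Cons.IH[where u = "u - c b"] eval_ArithI[OF Cons.prems(1) p]) auto
  qed
qed auto

definition val_of_option :: "'s option \<Rightarrow> 's val" where
  "val_of_option x = (case x of None \<Rightarrow> VNum 0 | Some b \<Rightarrow> VSym b)"

lemma val_of_option_simps [simp]:
  "val_of_option None = VNum 0" "val_of_option (Some b) = VSym b"
  by (simp_all add: val_of_option_def)

lemma val_of_option_eq_iff [simp]:
  "val_of_option x = VSym b \<longleftrightarrow> x = Some b" "val_of_option x = VNum 0 \<longleftrightarrow> x = None"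
  by (simp_all add: val_of_option_def split: option.splits)

text \<open>Comparing \<open>e\<close> with every symbol in turn converts its runtime value into a
  constant that \<open>h\<close> can use when the program is built; the final 0 passes an unknown
  value on.\<close>

definition case_expr :: "('m, 's) expr \<Rightarrow> 's list \<Rightarrow> ('s \<Rightarrow> ('m, 's) expr) \<Rightarrow> ('m, 's) expr" where
  "case_expr e bs h = foldr (\<lambda>b. IfEq e (SymConst b) (h b)) bs (IntConst 0)"

lemma eval_case_expr:
  assumes e: "eval P \<phi> U env e (val_of_option x)"
    and h: "\<And>b. x = Some b \<Longrightarrow> b \<in> set bs \<and> eval P \<phi> U env (h b) z"
    and "x = None \<Longrightarrow> z = VNum 0"
  shows "eval P \<phi> U env (case_expr e bs h) z"
proof -
  have "eval P \<phi> U env (case_expr e bs' h) z" if "\<And>b. x = Some b \<Longrightarrow> b \<in> set bs'" for bs'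
    using that
  proof (induction bs')
    case Nil
    then have "z = VNum 0"
      using assms(3) by (cases x) auto
    then show ?case
      by (auto simp: case_expr_def intro: eval_IntConstI)
  next
    case (Cons b bs')
    have "eval P \<phi> U env (IfEq e (SymConst b) (h b) (case_expr e bs' h)) z"
      using Cons h by (intro eval_IfEqI[OF e eval_eval_list.SymConst]) auto
    then show ?case
      by (simp add: case_expr_def)
  qed
  then show ?thesis
    using h by blast
qed

text \<open>An arbitrary rule \<open>f\<close> is compiled into a decision tree with one level per
  neighbour; \<open>a\<close> collects the symbols read on the way to a leaf.\<close>

primrec table_expr ::
    "('m \<Rightarrow> ('m, 's) expr) \<Rightarrow> 's list \<Rightarrow> (('m \<Rightarrow> 's) \<Rightarrow> 's) \<Rightarrow> 'm list \<Rightarrow> ('m \<Rightarrow> 's) \<Rightarrow> ('m, 's) expr" where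
  "table_expr g bs f [] a = SymConst (f a)"
| "table_expr g bs f (i # is) a = case_expr (g i) bs (\<lambda>b. table_expr g bs f is (a(i := b)))"

lemma eval_table_expr:
  assumes g: "\<And>i. eval P \<phi> U env (g i) (val_of_option (n i))" and bs: "set bs = UNIV"
  shows "eval P \<phi> U env (table_expr g bs f is a)
    (val_of_option (if \<exists>i\<in>set is. n i = None then None else Some (f (\<lambda>i. if i \<in> set is then the (n i) else a i))))"
proof (induction "is" arbitrary: a)
  case Nil
  then show ?case
    by (simp add: eval_eval_list.SymConst)
next
  case (Cons i "is")
  show ?case
    unfolding table_expr.simps
  proof (rule eval_case_expr[OF g])
    fix b assume b: "n i = Some b"
    have "(\<lambda>j. if j \<in> set is then the (n j) else (a(i := b)) j) =
        (\<lambda>j. if j \<in> set (i # is) then the (n j) else a j)"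
      using b by auto
    with Cons[of "a(i := b)"] b show "b \<in> set bs \<and> eval P \<phi> U env (table_expr g bs f is (a(i := b)))
        (val_of_option (if \<exists>i\<in>set (i # is). n i = None then None
          else Some (f (\<lambda>j. if j \<in> set (i # is) then the (n j) else a j))))"
      by (simp add: bs del: fun_upd_apply cong: if_cong)
  qed simp
qed

text \<open>These tests must precede the table, which answers unknown as soon as one neighbour is
  unknown, even when another one already forces \<alpha>.\<close>

definition spread_expr :: "('m \<Rightarrow> ('m, 's) expr) \<Rightarrow> 's \<Rightarrow> 'm list \<Rightarrow> ('m, 's) expr \<Rightarrow> ('m, 's) expr" where
  "spread_expr g \<alpha> is d = foldr (\<lambda>i. IfEq (g i) (SymConst \<alpha>) (SymConst \<alpha>)) is d"

lemma eval_spread_expr: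
  assumes g: "\<And>i. eval P \<phi> U env (g i) (val_of_option (n i))" and d: "eval P \<phi> U env d z"
  shows "eval P \<phi> U env (spread_expr g \<alpha> is d) (if \<exists>i\<in>set is. n i = Some \<alpha> then VSym \<alpha> else z)"
proof (induction "is")
  case Nil
  then show ?case
    using d by (simp add: spread_expr_def)
next
  case (Cons i "is")
  have "eval P \<phi> U env (IfEq (g i) (SymConst \<alpha>) (SymConst \<alpha>) (spread_expr g \<alpha> is d))
      (if \<exists>i\<in>set (i # is). n i = Some \<alpha> then VSym \<alpha> else z)"
    using Cons by (intro eval_IfEqI[OF g eval_eval_list.SymConst]) (auto intro: eval_eval_list.SymConst)
  then show ?case
    by (simp add: spread_expr_def)
qed

text \<open>The program reads the weight of \<open>b\<close> as the transition probability from the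
  tuple \<open>witness b\<close> to \<open>b\<close>; \<open>dirs\<close> lists the neighbours for
  the unrolled code.\<close>

locale noisy_automaton_sampler = noisy_automaton nb f \<alpha> c \<phi> syms
  for nb :: "'m::finite \<Rightarrow> int ^ 'd::finite" and f :: "('m \<Rightarrow> 's::finite) \<Rightarrow> 's" and \<alpha> c \<phi> syms +
  fixes witness :: "'s \<Rightarrow> 'm \<Rightarrow> 's" and dirs :: "'m list"
  assumes c_eq: "c b = \<phi> (witness b) b" and dirs: "set dirs = UNIV"
begin

text \<open>
  The functions of the program are: 0 the entry point, 1 the search for a sufficient depth, 2 the pattern
  at a given depth, 3 the symbol \<open>known r U t k\<close>, and 4 the numbering of the samples by \<open>code\<close>. The
  number 0 stands for an unknown symbol or pattern.
\<close>

definition cell_call :: "'m \<Rightarrow> ('m, 's) expr" where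
  "cell_call i = Call 3 [translate_expr (coords (nb i)) (Var 0),
     Arith Plus (Var 1) (IntConst 1), Arith Minus (Var 2) (IntConst 1)]"

text \<open>The layer is prepended to the coordinates to form the argument of the numbering, so that
  a cell reads the same sample on every visit and at every depth. Fresh samples would bias the
  result towards quickly determined patterns.\<close>

definition cell_expr :: "('m, 's) expr" where
  "cell_expr = IfEq (Var 2) (IntConst 0) (IntConst 0)
     (pick_expr (\<lambda>b. TransProb (witness b) b) syms (Uniform (Call 4 [expr.Cons (Var 1) (Var 0)]))
       (spread_expr cell_call \<alpha> dirs (table_expr cell_call syms f dirs (\<lambda>_. \<alpha>))))"

definition pattern_expr :: "('m, 's) expr" where
  "pattern_expr =
     (let cell = Call 3 [Head (Var 0), IntConst 0, Var 1]; rest = Call 2 [Tail (Var 0), Var 1]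
      in IfEq (Var 0) expr.Nil expr.Nil
           (IfEq cell (IntConst 0) (IntConst 0)
             (IfEq rest (IntConst 0) (IntConst 0) (expr.Cons cell rest))))"

definition deepen_call :: "('m, 's) expr" where
  "deepen_call = Call 1 [Var 0, Arith Plus (Var 1) (IntConst 1)]"

definition search_expr :: "('m, 's) expr" where
  "search_expr = IfEq (Call 2 [Var 0, Var 1]) (IntConst 0) deepen_call (Call 2 [Var 0, Var 1])"

definition sampler :: "('m, 's) program" where
  "sampler = [Call 1 [Var 0, IntConst 0], search_expr, pattern_expr, cell_expr, list_code_expr]"

lemma sampler_nth [simp]:
  "length sampler = 5" "sampler ! 0 = Call 1 [Var 0, IntConst 0]" "sampler ! Suc 0 = search_expr" "sampler ! 1 = search_expr"
  "sampler ! 2 = pattern_expr" "sampler ! 3 = cell_expr" "sampler ! 4 = list_code_expr"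
  by (simp_all add: sampler_def eval_nat_numeral)

abbreviation sampler_eval :: "(nat \<Rightarrow> real) \<Rightarrow> 's val list \<Rightarrow> ('m, 's) expr \<Rightarrow> 's val \<Rightarrow> bool" where
  "sampler_eval \<equiv> eval sampler \<phi>"

abbreviation sampler_eval_list :: "(nat \<Rightarrow> real) \<Rightarrow> 's val list \<Rightarrow> ('m, 's) expr list \<Rightarrow> 's val list \<Rightarrow> bool" where
  "sampler_eval_list \<equiv> eval_list sampler \<phi>"

section \<open>Correctness of the program\<close>

lemmas eval_args = eval_eval_list.List_Cons eval_eval_list.List_Nil

lemma eval_cell:
  "sampler_eval U [encode_site k, VNum (real t), VNum (real r)] cell_expr (val_of_option (known r U t k))"
proof (induction r arbitrary: t k)
  case 0
  show ?case
    unfolding cell_expr_def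
    by (rule eval_IfEqI[OF eval_VarI[OF _ refl] eval_IntConstI[OF refl]]) (auto intro: eval_IntConstI)
next
  case (Suc r)
  let ?env = "[encode_site k, VNum (real t), VNum (real (Suc r))]"
  let ?n = "\<lambda>i. known r U (Suc t) (k + nb i)"
  have call: "sampler_eval U ?env (cell_call i) (val_of_option (?n i))" for i
    unfolding cell_call_def
  proof (rule eval_eval_list.Call)
    have "sampler_eval U ?env (translate_expr (coords (nb i)) (Var 0)) (encode_site (k + nb i))"
      unfolding encode_site_eq coords_add by (rule eval_translate_expr) (auto intro: eval_VarI)
    moreover have "sampler_eval U ?env (Arith Plus (Var 1) (IntConst 1)) (VNum (real (Suc t)))"
      by (intro eval_ArithI[OF eval_VarI eval_IntConstI[OF refl]]) auto
    moreover have "sampler_eval U ?env (Arith Minus (Var 2) (IntConst 1)) (VNum (real r))"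
      by (intro eval_ArithI[OF eval_VarI eval_IntConstI[OF refl]]) auto
    ultimately show "sampler_eval_list U ?env
        [translate_expr (coords (nb i)) (Var 0), Arith Plus (Var 1) (IntConst 1), Arith Minus (Var 2) (IntConst 1)]
        [encode_site (k + nb i), VNum (real (Suc t)), VNum (real r)]"
      by (intro eval_args)
  qed (use Suc in \<open>simp_all del: of_nat_Suc\<close>)
  have "sampler_eval U ?env (Call 4 [expr.Cons (Var 1) (Var 0)]) (VNum (real (code t k)))"
  proof (rule eval_eval_list.Call)
    show "sampler_eval_list U ?env [expr.Cons (Var 1) (Var 0)] [val_of_ints (int t # coords k)]"
      unfolding list.map val_of_list_simps by (intro eval_args eval_eval_list.Cons eval_VarI) (auto simp: encode_site_eq)
    show "sampler_eval U [val_of_ints (int t # coords k)] (sampler ! 4) (VNum (real (code t k)))"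
      unfolding code_def sampler_nth by (rule eval_list_code_expr) simp_all
  qed simp
  then have uniform: "sampler_eval U ?env (Uniform (Call 4 [expr.Cons (Var 1) (Var 0)])) (VNum (U (code t k)))"
    by (rule eval_eval_list.Uniform)
  have prob: "sampler_eval U ?env (TransProb (witness b) b) (VNum (c b))" for b
    unfolding c_eq by (rule eval_eval_list.TransProb)
  have table: "sampler_eval U ?env (table_expr cell_call syms f dirs (\<lambda>_. \<alpha>))
      (val_of_option (if \<exists>i. ?n i = None then None else Some (f (\<lambda>i. the (?n i)))))"
    using eval_table_expr[of sampler \<phi> U ?env cell_call ?n syms f dirs "\<lambda>_. \<alpha>", OF call syms(2)]
    by (simp add: dirs cong: if_cong)
  have "sampler_eval U ?env (spread_expr cell_call \<alpha> dirs (table_expr cell_call syms f dirs (\<lambda>_. \<alpha>)))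
      (val_of_option (deduce None ?n))"
  proof -
    have "val_of_option (deduce None ?n) = (if \<exists>i\<in>set dirs. ?n i = Some \<alpha> then VSym \<alpha>
        else val_of_option (if \<exists>i. ?n i = None then None else Some (f (\<lambda>i. the (?n i)))))"
      by (simp add: deduce_def dirs)
    then show ?thesis
      using eval_spread_expr[of sampler \<phi> U ?env cell_call ?n, OF call table, of \<alpha> dirs] by simp
  qed
  then have "sampler_eval U ?env
      (pick_expr (\<lambda>b. TransProb (witness b) b) syms (Uniform (Call 4 [expr.Cons (Var 1) (Var 0)]))
       (spread_expr cell_call \<alpha> dirs (table_expr cell_call syms f dirs (\<lambda>_. \<alpha>))))
      (val_of_option (known (Suc r) U t k))"
    by (intro eval_pick_expr[OF prob uniform]) (auto simp: noise_def deduce_def)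
  then show ?case
    unfolding cell_expr_def by (intro eval_IfEqI[OF eval_VarI[OF _ refl] eval_IntConstI[OF refl]]) auto
qed

text \<open>At a fixed depth evaluation always ends; an unknown symbol anywhere turns the result
  into 0, which no list equals.\<close>

lemma eval_pattern:
  "sampler_eval U [val_of_list (map encode_site ks), VNum (real r)] pattern_expr
    (if \<forall>k\<in>set ks. known r U 0 k \<noteq> None
     then val_of_list (map (\<lambda>k. VSym (the (known r U 0 k))) ks) else VNum 0)"
proof (induction ks)
  case Nil
  show ?case
    unfolding pattern_expr_def Let_def
    by (rule eval_IfEqI[OF eval_VarI[OF _ refl] eval_eval_list.Nil]) (auto intro: eval_eval_list.Nil)
next
  case (Cons k ks)
  let ?env = "[val_of_list (map encode_site (k # ks)), VNum (real r)]"
  let ?v = "if \<forall>k\<in>set ks. known r U 0 k \<noteq> None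
     then val_of_list (map (\<lambda>k. VSym (the (known r U 0 k))) ks) else VNum 0"
  have var: "sampler_eval U ?env (Var 0) (VCons (encode_site k) (val_of_list (map encode_site ks)))"
    "sampler_eval U ?env (Var 1) (VNum (real r))"
    by (auto intro: eval_VarI)
  have cell: "sampler_eval U ?env (Call 3 [Head (Var 0), IntConst 0, Var 1]) (val_of_option (known r U 0 k))"
  proof (rule eval_eval_list.Call)
    show "sampler_eval_list U ?env [Head (Var 0), IntConst 0, Var 1] [encode_site k, VNum (real 0), VNum (real r)]"
      by (intro eval_args eval_eval_list.Head[OF var(1)] var(2) eval_IntConstI) simp
  qed (use eval_cell[of U k 0 r] in simp_all)
  have rest: "sampler_eval U ?env (Call 2 [Tail (Var 0), Var 1]) ?v"
  proof (rule eval_eval_list.Call)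
    show "sampler_eval_list U ?env [Tail (Var 0), Var 1] [val_of_list (map encode_site ks), VNum (real r)]"
      by (intro eval_args eval_eval_list.Tail[OF var(1)] var(2))
  qed (use Cons in simp_all)
  show ?case
    unfolding pattern_expr_def Let_def
  proof (rule eval_IfEqI[OF var(1) eval_eval_list.Nil])
    show "sampler_eval U ?env
        (IfEq (Call 3 [Head (Var 0), IntConst 0, Var 1]) (IntConst 0) (IntConst 0)
          (IfEq (Call 2 [Tail (Var 0), Var 1]) (IntConst 0) (IntConst 0)
            (expr.Cons (Call 3 [Head (Var 0), IntConst 0, Var 1]) (Call 2 [Tail (Var 0), Var 1]))))
        (if \<forall>k\<in>set (k # ks). known r U 0 k \<noteq> None
         then val_of_list (map (\<lambda>k. VSym (the (known r U 0 k))) (k # ks)) else VNum 0)"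
    proof (rule eval_IfEqI[OF cell eval_IntConstI[OF refl]])
      assume "val_of_option (known r U 0 k) \<noteq> VNum (real_of_int 0)"
      then obtain b where b: "known r U 0 k = Some b"
        by auto
      show "sampler_eval U ?env
          (IfEq (Call 2 [Tail (Var 0), Var 1]) (IntConst 0) (IntConst 0)
            (expr.Cons (Call 3 [Head (Var 0), IntConst 0, Var 1]) (Call 2 [Tail (Var 0), Var 1])))
          (if \<forall>k\<in>set (k # ks). known r U 0 k \<noteq> None
           then val_of_list (map (\<lambda>k. VSym (the (known r U 0 k))) (k # ks)) else VNum 0)"
        using eval_eval_list.Cons[OF cell rest] b
        by (intro eval_IfEqI[OF rest eval_IntConstI[OF refl]]) (auto intro: eval_IntConstI split: if_splits)
    qed (auto intro: eval_IntConstI)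
  qed simp
qed

lemma eval_pattern_call:
  "sampler_eval U [val_of_list (map encode_site ks), VNum (real r)] (Call 2 [Var 0, Var 1])
    (if \<forall>k\<in>set ks. known r U 0 k \<noteq> None
     then val_of_list (map (\<lambda>k. VSym (the (known r U 0 k))) ks) else VNum 0)"
proof (rule eval_eval_list.Call)
  show "sampler_eval_list U [val_of_list (map encode_site ks), VNum (real r)] [Var 0, Var 1]
      [val_of_list (map encode_site ks), VNum (real r)]"
    by (intro eval_args eval_VarI) simp_all
  show "sampler_eval U [val_of_list (map encode_site ks), VNum (real r)] (sampler ! 2)
      (if \<forall>k\<in>set ks. known r U 0 k \<noteq> None
       then val_of_list (map (\<lambda>k. VSym (the (known r U 0 k))) ks) else VNum 0)"
    unfolding sampler_nth by (rule eval_pattern)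
qed simp

lemma eval_deepen_args:
  "sampler_eval_list U [v, VNum (real r)] [Var 0, Arith Plus (Var 1) (IntConst 1)] [v, VNum (real (Suc r))]"
  by (intro eval_args eval_ArithI[OF eval_VarI eval_IntConstI[OF refl]] eval_VarI) auto

text \<open>Induction downwards from a sufficient depth \<open>r'\<close>: a smaller depth either
  fails and leads one step deeper, or succeeds with the same symbols, since \<open>known\<close> is
  monotone in the depth.\<close>

lemma eval_search:
  assumes known: "\<forall>k\<in>set ks. known r' U 0 k = Some (w k)" and "r \<le> r'"
  shows "sampler_eval U [val_of_list (map encode_site ks), VNum (real r)] search_expr
    (val_of_list (map (\<lambda>k. VSym (w k)) ks))"
  using \<open>r \<le> r'\<close>
proof (induction rule: inc_induct)
  case base
  have eq: "map (\<lambda>k. VSym (the (known r' U 0 k))) ks = map (\<lambda>k. VSym (w k)) ks"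
    and all: "\<forall>k\<in>set ks. known r' U 0 k \<noteq> None"
    using known by simp_all
  from eval_pattern_call[of U ks r']
  have pattern: "sampler_eval U [val_of_list (map encode_site ks), VNum (real r')] (Call 2 [Var 0, Var 1])
      (val_of_list (map (\<lambda>k. VSym (w k)) ks))"
    unfolding if_P[OF all] eq .
  show ?case
    unfolding search_expr_def by (rule eval_IfEqI[OF pattern eval_IntConstI[OF refl]]) (simp, rule pattern)
next
  case (step r)
  show ?case
    unfolding search_expr_def
  proof (rule eval_IfEqI[OF eval_pattern_call eval_IntConstI[OF refl]])
    show "sampler_eval U [val_of_list (map encode_site ks), VNum (real r)] deepen_call
        (val_of_list (map (\<lambda>k. VSym (w k)) ks))"
      unfolding deepen_call_def
      by (rule eval_eval_list.Call[OF _ eval_deepen_args]) (simp, simp only: sampler_nth, rule step.IH)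
    assume "(if \<forall>k\<in>set ks. known r U 0 k \<noteq> None
        then val_of_list (map (\<lambda>k. VSym (the (known r U 0 k))) ks) else VNum 0) \<noteq> VNum (real_of_int 0)"
    then have all: "\<forall>k\<in>set ks. known r U 0 k \<noteq> None"
      by (auto split: if_splits)
    have "the (known r U 0 k) = w k" if "k \<in> set ks" for k
    proof -
      have "known r U 0 k \<noteq> None"
        using all that by (rule bspec)
      then obtain b where "known r U 0 k = Some b"
        by (cases "known r U 0 k") simp_all
      then show ?thesis
        using known_mono[of r r' U 0 k b] known that step.hyps by simp
    qed
    then have eq: "map (\<lambda>k. VSym (the (known r U 0 k))) ks = map (\<lambda>k. VSym (w k)) ks"
      by simp
    from eval_pattern_call[of U ks r]
    show "sampler_eval U [val_of_list (map encode_site ks), VNum (real r)] (Call 2 [Var 0, Var 1])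
        (val_of_list (map (\<lambda>k. VSym (w k)) ks))"
      unfolding if_P[OF all] eq .
  qed
qed

text \<open>A divergent search has no finite derivation, so the induction runs over derivations.
  \<open>search_expr\<close> and \<open>deepen_call\<close> are treated together because each leads
  to the other.\<close>

lemma search_terminates_imp_known:
  assumes "sampler_eval U env e v"
    and "\<exists>r. env = [val_of_list (map encode_site ks), VNum (real r)] \<and> (e = search_expr \<or> e = deepen_call)"
  shows "\<exists>r. \<forall>k\<in>set ks. known r U 0 k \<noteq> None"
  using assms
proof (induction rule: eval_eval_list.inducts(1)[where ?P2.0 = "\<lambda>_ _ _. True"])
  case (IfEq env e1 v e2 w e3 e4 z)
  then obtain r where env: "env = [val_of_list (map encode_site ks), VNum (real r)]"
    and e: "e1 = Call 2 [Var 0, Var 1]" "e2 = IntConst 0" "e3 = deepen_call"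
    by (auto simp: search_expr_def deepen_call_def)
  have w: "w = VNum 0"
    using eval_deterministic[OF eval_IntConstI[OF refl]] IfEq.hyps(2) unfolding e by fastforce
  show ?case
  proof (cases "v = w")
    case True
    then show ?thesis
      using IfEq.IH(3) env e by auto
  next
    case False
    have "v = (if \<forall>k\<in>set ks. known r U 0 k \<noteq> None
        then val_of_list (map (\<lambda>k. VSym (the (known r U 0 k))) ks) else VNum 0)"
      using eval_deterministic[OF eval_pattern_call[of U ks r]] IfEq.hyps(1) unfolding e env by simp
    with False w show ?thesis
      by (auto split: if_splits)
  qed
next
  case (Call g env es vs z)
  then obtain r where env: "env = [val_of_list (map encode_site ks), VNum (real r)]"
    and e: "g = 1" "es = [Var 0, Arith Plus (Var 1) (IntConst 1)]"
    by (auto simp: search_expr_def deepen_call_def)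
  have "vs = [val_of_list (map encode_site ks), VNum (real (Suc r))]"
    using eval_list_deterministic[OF eval_deepen_args] Call.hyps unfolding e env by simp
  then show ?case
    using Call.IH e by (auto simp del: of_nat_Suc)
qed (auto simp: search_expr_def deepen_call_def)

lemma outputs_iff_known:
  "outputs sampler \<phi> U ks w \<longleftrightarrow> (\<exists>r. \<forall>k\<in>set ks. known r U 0 k = Some (w k))"
proof
  have search: "outputs sampler \<phi> U ks w" if "\<forall>k\<in>set ks. known r U 0 k = Some (w k)" for r w
  proof -
    let ?L = "val_of_list (map encode_site ks)" and ?v = "val_of_list (map (\<lambda>k. VSym (w k)) ks)"
    have "sampler_eval U [?L] (Call 1 [Var 0, IntConst 0]) ?v"
      by (rule eval_eval_list.Call[where vs = "[?L, VNum (real 0)]"])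
        (use eval_search[OF that, of 0] in \<open>auto intro!: eval_args eval_VarI eval_IntConstI\<close>)
    then have "sampler_eval U [?L] (Call 0 [Var 0]) ?v"
      by (intro eval_eval_list.Call[where vs = "[?L]"]) (auto intro!: eval_args eval_VarI)
    then show ?thesis
      by (simp add: outputs_def)
  qed
  then show "outputs sampler \<phi> U ks w" if "\<exists>r. \<forall>k\<in>set ks. known r U 0 k = Some (w k)"
    using that by blast
  assume out: "outputs sampler \<phi> U ks w"
  let ?L = "val_of_list (map encode_site ks)"
  from out have "sampler_eval U [?L] (Call 0 [Var 0]) (val_of_list (map (\<lambda>k. VSym (w k)) ks))"
    by (simp add: outputs_def)
  then obtain vs where "sampler_eval_list U [?L] [Var 0] vs"
    and main: "sampler_eval U vs (Call 1 [Var 0, IntConst 0]) (val_of_list (map (\<lambda>k. VSym (w k)) ks))"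
    by (rule eval_cases(13)) (simp only: sampler_nth)
  moreover have "sampler_eval_list U [?L] [Var 0] [?L]"
    by (intro eval_args eval_VarI) simp_all
  ultimately have "vs = [?L]"
    using eval_list_deterministic by blast
  from main this obtain vs' where "sampler_eval_list U [?L] [Var 0, IntConst 0] vs'"
    and search_eval: "sampler_eval U vs' search_expr (val_of_list (map (\<lambda>k. VSym (w k)) ks))"
    by - (erule eval_cases(13), simp only: sampler_nth)
  moreover have "sampler_eval_list U [?L] [Var 0, IntConst 0] [?L, VNum (real 0)]"
    by (intro eval_args eval_VarI eval_IntConstI) simp_all
  ultimately have "vs' = [?L, VNum (real 0)]"
    using eval_list_deterministic by blast
  with search_eval obtain r where r: "\<forall>k\<in>set ks. known r U 0 k \<noteq> None"
    using search_terminates_imp_known by blast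
  \<comment> \<open>Termination yields a sufficient depth but does not yet identify its symbols with
    \<open>w\<close>. By the direction already shown these symbols are an output too, and evaluation
    is deterministic.\<close>
  let ?w = "\<lambda>k. the (known r U 0 k)"
  have "outputs sampler \<phi> U ks ?w"
    by (rule search[of r]) (use r in auto)
  then have "map (\<lambda>k. VSym (?w k)) ks = map (\<lambda>k. VSym (w k)) ks"
    using out eval_deterministic unfolding outputs_def by (metis val_of_list_eq_iff)
  then have "\<forall>k\<in>set ks. the (known r U 0 k) = w k"
    by simp
  then have "\<forall>k\<in>set ks. known r U 0 k = Some (w k)"
    using r by (metis option.collapse)
  then show "\<exists>r. \<forall>k\<in>set ks. known r U 0 k = Some (w k)" ..
qed

lemma perfect_sampler: "perfect_sampler sampler \<phi> (limit_law 0)"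
  unfolding perfect_sampler_def outputs_iff_known
proof (intro allI impI conjI)
  fix ks :: "(int ^ 'd) list" and w :: "int ^ 'd \<Rightarrow> 's"
  let ?E = "{U \<in> space uniform_source. \<exists>r. \<forall>k\<in>set ks. known r U 0 k = Some (w k)}"
  let ?F = "{U \<in> space uniform_source. limit U 0 \<in> cyl (set ks) w}"
  show E: "?E \<in> sets uniform_source"
    by measurable
  have [measurable]: "cyl (set ks) w \<in> sets configs"
    by (rule sets_configs_finite_dependence[OF _ cyl_cong]) auto
  have F: "?F \<in> sets uniform_source"
    by measurable
  have "measure (limit_law 0) (cyl (set ks) w) = uniform_source.prob ?F"
    unfolding limit_law_def by (subst measure_distr) (auto simp: vimage_def)
  also have "\<dots> = uniform_source.prob ?E"
  proof (rule measure_eq_AE)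
    show "AE U in uniform_source. U \<in> ?F \<longleftrightarrow> U \<in> ?E"
      using AE_known[of 0]
    proof eventually_elim
      case (elim U)
      then obtain R where R: "known (R k) U 0 k \<noteq> None" for k
        by metis
      \<comment> \<open>The sum of the individual depths is a common bound for the finitely many
        sites.\<close>
      have "known (\<Sum>k\<in>set ks. R k) U 0 k = Some (limit U 0 k)" if "k \<in> set ks" for k
      proof -
        obtain b where "known (R k) U 0 k = Some b"
          using R by blast
        moreover have "R k \<le> (\<Sum>k\<in>set ks. R k)"
          using that by (intro member_le_sum) auto
        ultimately show ?thesis
          using known_mono known_imp_limit by metis
      qed
      then have "U \<in> ?E" if "U \<in> ?F"
        using that by (auto simp: cyl_def)
      moreover have "U \<in> ?F" if "U \<in> ?E"
        using that by (auto simp: cyl_def dest: known_imp_limit)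
      ultimately show ?case
        by blast
    qed
  qed (use E F in auto)
  finally show "uniform_source.prob ?E = measure (limit_law 0) (cyl (set ks) w)" ..
qed

end

section \<open>Noise weights that the program can read\<close>

theorem theorem3p10:
  fixes nb :: "'m::finite \<Rightarrow> int ^ 'd::finite"
    and f :: "('m \<Rightarrow> 's::finite) \<Rightarrow> 's"
    and \<alpha> :: 's
    and \<epsilon> :: real
    and q :: "'s pmf"
  assumes "inj nb"
    and "spreading nb f \<alpha>"
    and "0 < \<epsilon>" and "\<epsilon> \<le> 1"
    and "pmf q \<alpha> > 0"
  shows "uniformly_ergodic (pca nb (noisy_rule \<epsilon> q f)) \<and>
    (\<forall>\<pi>. invariant_measure (pca nb (noisy_rule \<epsilon> q f)) \<pi> \<longrightarrow>
       spatially_mixing \<pi> \<and> admits_perfect_sampling (noisy_rule \<epsilon> q f) \<pi>)"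
proof -
  let ?\<phi> = "noisy_rule \<epsilon> q f"
  have stoch: "stochastic ?\<phi>"
    using assms(3,4) by (intro stochastic_noisy_rule) auto
  have \<phi>_ge: "\<epsilon> * pmf q b \<le> ?\<phi> a b" for a b
    using assms(4) by (simp add: noisy_rule_def memoryless_noise_def)
  have spread: "f a = \<alpha>" if "a i = \<alpha>" for a i
  proof -
    \<comment> \<open>Injectivity of \<open>nb\<close> lets a configuration realise the tuple
      \<open>a\<close> around the origin, which turns spreading into a statement about
      \<open>f\<close>.\<close>
    let ?x = "\<lambda>k. a (inv nb k)"
    have "?x (0 + nb j) = a j" for j
      using assms(1) by (simp add: inv_f_f)
    then have "ca nb f ?x 0 = f a" and "\<exists>n\<in>range nb. ?x (0 + n) = \<alpha>"
      using that by (auto simp: ca_def)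
    then show ?thesis
      using assms(2) unfolding spreading_def by metis
  qed
  text \<open>
    The program may only use transition probabilities, so the weights \<open>c b\<close> of the noise have to be
    among them. If \<open>f\<close> is constant, then the whole transition counts as noise.
  \<close>
  obtain c witness where c: "\<And>b. c b = ?\<phi> (witness b) b" "sum c UNIV \<le> 1"
    and \<phi>: "\<And>a b. ?\<phi> a b = (1 - sum c UNIV) * indicator {f a} b + c b"
  proof (cases "\<forall>a. f a = \<alpha>")
    case True
    have "sum (?\<phi> (\<lambda>_. \<alpha>)) UNIV = 1"
      using stoch by (simp add: stochastic_def)
    moreover have "?\<phi> a b = ?\<phi> (\<lambda>_. \<alpha>) b" for a b
      using True by (simp add: noisy_rule_def)
    ultimately show ?thesis
      by (intro that[of "?\<phi> (\<lambda>_. \<alpha>)" "\<lambda>_ _. \<alpha>"]) auto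
  next
    case False
    \<comment> \<open>The all-\<alpha> tuple avoids every \<open>b\<close> other than \<alpha>, and
      the case assumption provides a tuple that avoids \<alpha>. At such a tuple the transition
      probability to \<open>b\<close> is exactly \<open>\<epsilon> * pmf q b\<close>.\<close>
    then have "\<exists>a. f a \<noteq> b" for b
      using spread[of "\<lambda>_. \<alpha>"] by (cases "b = \<alpha>") auto
    then obtain witness where witness: "b \<noteq> f (witness b)" for b
      by metis
    moreover have "(\<Sum>b\<in>UNIV. \<epsilon> * pmf q b) = \<epsilon>"
      by (simp add: sum_pmf_eq_1 flip: sum_distrib_left)
    ultimately show ?thesis
      using assms(4) by (intro that[of "\<lambda>b. \<epsilon> * pmf q b" witness])
        (auto simp: noisy_rule_def memoryless_noise_def indicator_def)
  qed
  obtain syms where syms: "set syms = (UNIV :: 's set)" "distinct syms"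
    using finite_distinct_list[of "UNIV :: 's set"] by auto
  obtain dirs where dirs: "set dirs = (UNIV :: 'm set)"
    using finite_list[of "UNIV :: 'm set"] by auto
  \<comment> \<open>In both cases \<open>c \<alpha>\<close> is a transition probability to \<alpha>,
    hence bounded below by the noise.\<close>
  have "0 < \<epsilon> * pmf q \<alpha>"
    using assms(3,5) by simp
  also have "\<dots> \<le> c \<alpha>"
    unfolding c(1) by (rule \<phi>_ge)
  finally have "0 < c \<alpha>" .
  interpret noisy_automaton_sampler nb f \<alpha> c ?\<phi> syms witness dirs
  proof
    show "0 \<le> c b" for b
      using stoch c(1) by (simp add: stochastic_def)
  qed (fact syms dirs c \<phi> spread \<open>0 < c \<alpha>\<close>)+
  show ?thesis
    using uniformly_ergodic spatially_mixing perfect_sampler invariant_eq_limit_law[where t = 0]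
    unfolding admits_perfect_sampling_def by blast
qed

end
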